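(* Let $(\mathbf d_n)_{n\ge1}$ be a family of degree sequences and $v_n\in[n]$. Assume, as $n\to\infty$, \[\sigma^2(\mathbf d_n)=o\Big(\frac{n}{(\log n)^3}\Big),\qquad \sigma^2(\mathbf d_n)=\omega(n^{-1}),\qquad \Delta(\mathbf d_n)=o\Big(\sqrt{\frac{n\sigma^2(\mathbf d_n)}{(\log n)^3}}\Big).\] Let $X$ be standard Rayleigh distributed ($\mathbb P(X>x)=e^{-x^2/2}$, $x>0$). Then for every $p\ge1$, \[\lim_{n\to\infty}\mathbb E\Big[\Big(\frac{\mathfrak s_n(v_n)}{\sqrt{n/\sigma^2(\mathbf d_n)}}\Big)^p\Big]=\mathbb E[X^p].\] In particular $\mathbb E[\mathfrak s_n(v_n)]\sim\sqrt{\pi n/(2\sigma^2(\mathbf d_n))}$ and $\mathrm{Var}(\mathfrak s_n(v_n))\sim\frac{(4-\pi)n}{2\sigma^2(\mathbf d_n)}$.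
   Context: A degree sequence is $\mathbf d_n=(d_{n,1},\ldots,d_{n,n})\in\mathbb N_0^n$ with $\sum_j d_{n,j}=n$. For such a sequence let $\mathfrak F(\mathbf d_n)=\{f:[n]\to[n]: |f^{-1}(\{i\})|=d_{n,i}\ \forall i\in[n]\}$; a random functional graph with degree sequence $\mathbf d_n$ is the graph with edges $\{(v,F(v))\}$ where $F$ is uniform on $\mathfrak F(\mathbf d_n)$. For $f:V\to V$ and $v\in V$, the six-length is $\mathfrak s_f(v)=\min\{k\in\mathbb N: f^{(k)}(v)\in\{f^{(j)}(v):0\le j\le k-1\}\}$ ($f^{(k)}$ the $k$-fold composition, $f^{(0)}=\mathrm{id}$); $\mathfrak s_n(v)$ denotes $\mathfrak s_F(v)$ for $F$ uniform on $\mathfrak F(\mathbf d_n)$. Notation: $\Delta(\mathbf d_n)=\max_j d_{n,j}$, $m_k(\mathbf d_n)=\sum_j d_{n,j}^k$, $\sigma^2(\mathbf d_n)=m_2(\mathbf d_n)/n-1$. $a_n=\omega(b_n)$ means $b_n=o(a_n)$. *)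

theory Defs
  imports "HOL-Analysis.Analysis" "HOL-Library.Landau_Symbols"
begin

text \<open>Vertex set [n] = {1..n}. A degree sequence is d :: nat => nat, read on {1..n}.\<close>

definition is_degree_seq :: "nat \<Rightarrow> (nat \<Rightarrow> nat) \<Rightarrow> bool" where
  "is_degree_seq n d \<longleftrightarrow> (\<Sum>j\<in>{1..n}. d j) = n"

definition funs_deg :: "nat \<Rightarrow> (nat \<Rightarrow> nat) \<Rightarrow> (nat \<Rightarrow> nat) set" where
  "funs_deg n d = {f \<in> {1..n} \<rightarrow>\<^sub>E {1..n}.
      \<forall>i\<in>{1..n}. card {v \<in> {1..n}. f v = i} = d i}"

definition six_length :: "('a \<Rightarrow> 'a) \<Rightarrow> 'a \<Rightarrow> nat" where
  "six_length f v = (LEAST k. 1 \<le> k \<and> (f ^^ k) v \<in> {(f ^^ j) v | j. j \<le> k - 1})"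

definition exp_six :: "nat \<Rightarrow> (nat \<Rightarrow> nat) \<Rightarrow> nat \<Rightarrow> (nat \<Rightarrow> real) \<Rightarrow> real" where
  "exp_six n d v g = (\<Sum>f\<in>funs_deg n d. g (six_length f v)) / real (card (funs_deg n d))"

definition max_deg :: "nat \<Rightarrow> (nat \<Rightarrow> nat) \<Rightarrow> nat" where
  "max_deg n d = Max (d ` {1..n})"

definition moment :: "nat \<Rightarrow> (nat \<Rightarrow> nat) \<Rightarrow> nat \<Rightarrow> nat" where
  "moment n d k = (\<Sum>j\<in>{1..n}. d j ^ k)"

definition sigma2 :: "nat \<Rightarrow> (nat \<Rightarrow> nat) \<Rightarrow> real" where
  "sigma2 n d = real (moment n d 2) / real n - 1"

text \<open>Moments of standard Rayleigh variable X, density x * exp(-x^2/2) on (0,oo).\<close>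
definition rayleigh_moment :: "real \<Rightarrow> real" where
  "rayleigh_moment p = (LBINT x:{0<..}. x powr p * (x * exp (- (x\<^sup>2) / 2)))"

end

theory Submission
  imports Defs "HOL-Probability.Sinc_Integral" "HOL-Real_Asymp.Real_Asymp"
begin

text \<open>Revealing the walk from \<open>v\<close> one step at a time shows that the six-length exceeds \<open>k\<close> with
  probability \<open>p\<^sub>k = e\<^sub>k / binomial n k\<close>, where \<open>e\<^sub>k\<close> is the elementary symmetric polynomial of the
  degrees of the vertices other than \<open>v\<close>. If \<open>k\<close> is replaced by a binomial variable \<open>N\<close> with
  parameters \<open>n\<close> and \<open>t\<close>, the mean of \<open>p\<^sub>N\<close> is the product of \<open>1 - t\<close> and the factors
  \<open>1 + (d j - 1) t\<close> with \<open>j \<noteq> v\<close>. Since the \<open>d j - 1\<close> sum to \<open>0\<close> and their squares to \<open>n \<sigma>\<^sup>2\<close>, this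
  product tends to \<open>exp (- x\<^sup>2 / 2)\<close> when \<open>t = x / sqrt (n \<sigma>\<^sup>2)\<close>. As \<open>p\<^sub>k\<close> is decreasing and \<open>N\<close>
  concentrates around \<open>n t = x sqrt (n / \<sigma>\<^sup>2)\<close>, the survival function itself converges. The same
  product, with half the value of \<open>t\<close> and Markov's inequality, bounds the tails uniformly in \<open>n\<close> by
  any power of \<open>x\<close>, so dominated convergence gives the moments.\<close>

subsection \<open>Elementary symmetric polynomials\<close>

definition esym :: "nat \<Rightarrow> 'a set \<Rightarrow> ('a \<Rightarrow> 'b::comm_semiring_1) \<Rightarrow> 'b" where
  "esym k A x = (\<Sum>S | S \<subseteq> A \<and> card S = k. \<Prod>j\<in>S. x j)"

lemma esym_0: "finite A \<Longrightarrow> esym 0 A x = 1"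
proof -
  assume "finite A"
  then have "{S. S \<subseteq> A \<and> card S = 0} = {{}}"
    by (auto dest: finite_subset)
  then show ?thesis by (simp add: esym_def)
qed

lemma esym_eq_0:
  assumes "finite A" "card A < k"
  shows "esym k A x = 0"
proof -
  have "{S. S \<subseteq> A \<and> card S = k} = {}"
    using assms(2) by (auto dest: card_mono[OF assms(1)])
  then show ?thesis by (simp only: esym_def sum.empty)
qed

lemma esym_cong: "(\<And>j. j \<in> A \<Longrightarrow> x j = y j) \<Longrightarrow> esym k A x = esym k A y"
  unfolding esym_def by (intro sum.cong prod.cong refl) auto

lemma of_nat_esym: "of_nat (esym k A x) = esym k A (\<lambda>j. of_nat (x j))"
  by (simp add: esym_def)

text \<open>Double counting: a set \<open>S\<close> of size \<open>Suc k\<close> arises from the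
  pairs \<open>(b, S - {b})\<close>, once for each of its \<open>Suc k\<close> elements.\<close>

lemma sum_esym_remove:
  assumes A: "finite A"
  shows "(\<Sum>b\<in>A. x b * esym k (A - {b}) x) = of_nat (Suc k) * esym (Suc k) A x"
proof -
  let ?F = "{S. S \<subseteq> A \<and> card S = Suc k}"
  have fin: "finite ?F" using A by simp
  have "(\<Sum>b\<in>A. x b * esym k (A - {b}) x) = (\<Sum>b\<in>A. \<Sum>S | S \<in> ?F \<and> b \<in> S. \<Prod>j\<in>S. x j)"
  proof (rule sum.cong)
    fix b assume b: "b \<in> A"
    show "x b * esym k (A - {b}) x = (\<Sum>S | S \<in> ?F \<and> b \<in> S. \<Prod>j\<in>S. x j)"
      unfolding esym_def sum_distrib_left
    proof (rule sum.reindex_bij_witness[where j = "insert b" and i = "\<lambda>S. S - {b}"])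
      fix S assume S: "S \<in> {S. S \<subseteq> A - {b} \<and> card S = k}"
      then have f: "finite S" "b \<notin> S" using A finite_subset[of S A] by auto
      show "insert b S \<in> {S \<in> ?F. b \<in> S}" "insert b S - {b} = S"
        using S b f by auto
      show "(\<Prod>j\<in>insert b S. x j) = x b * (\<Prod>j\<in>S. x j)"
        using f by simp
    qed (use A finite_subset in auto)
  qed simp
  also have "\<dots> = (\<Sum>S\<in>?F. \<Sum>b | b \<in> A \<and> b \<in> S. \<Prod>j\<in>S. x j)"
    using A fin by (rule sum.swap_restrict)
  also have "\<dots> = (\<Sum>S\<in>?F. of_nat (Suc k) * (\<Prod>j\<in>S. x j))"
  proof (rule sum.cong)
    fix S assume S: "S \<in> ?F"
    then have "{b. b \<in> A \<and> b \<in> S} = S" by auto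
    then show "(\<Sum>b | b \<in> A \<and> b \<in> S. \<Prod>j\<in>S. x j) = of_nat (Suc k) * (\<Prod>j\<in>S. x j)"
      using S by simp
  qed simp
  finally show ?thesis by (simp only: esym_def sum_distrib_left)
qed

text \<open>Expand the product, let \<open>S\<close> be the set of factors contributing
  \<open>t * x j\<close>, and group by \<open>card S\<close>. With \<open>s = 1 - t\<close> the left
  side has the shape of a Bernstein sum.\<close>

lemma sum_esym_homogeneous:
  fixes x :: "'a \<Rightarrow> real"
  assumes A: "finite A"
  shows "(\<Sum>k\<le>card A. esym k A x * t ^ k * s ^ (card A - k)) = (\<Prod>j\<in>A. t * x j + s)"
proof -
  have "(\<Prod>j\<in>A. t * x j + s) = (\<Sum>S\<in>Pow A. (\<Prod>j\<in>S. t * x j) * (\<Prod>j\<in>A - S. s))"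
    by (rule prod_add[OF A])
  also have "\<dots> = (\<Sum>S\<in>Pow A. (\<Prod>j\<in>S. x j) * t ^ card S * s ^ (card A - card S))"
  proof (rule sum.cong)
    fix S assume "S \<in> Pow A"
    then have S: "S \<subseteq> A" "finite S" using A finite_subset by auto
    show "(\<Prod>j\<in>S. t * x j) * (\<Prod>j\<in>A - S. s) = (\<Prod>j\<in>S. x j) * t ^ card S * s ^ (card A - card S)"
      using S by (simp add: prod.distrib card_Diff_subset)
  qed simp
  also have "\<dots> = (\<Sum>k\<le>card A. \<Sum>S | S \<in> Pow A \<and> card S = k. (\<Prod>j\<in>S. x j) * t ^ card S * s ^ (card A - card S))"
    by (rule sum.group[symmetric]) (use A in \<open>auto intro: card_mono\<close>)
  also have "\<dots> = (\<Sum>k\<le>card A. esym k A x * t ^ k * s ^ (card A - k))"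
    unfolding esym_def sum_distrib_right by (intro sum.cong refl) auto
  finally show ?thesis by simp
qed

subsection \<open>Maps with prescribed fibre sizes\<close>

text \<open>Domain and codomain are kept apart: revealing values one at a time shrinks the domain
  while the codomain stays fixed.\<close>

definition fibre_maps :: "'a set \<Rightarrow> 'b set \<Rightarrow> ('b \<Rightarrow> nat) \<Rightarrow> ('a \<Rightarrow> 'b) set" where
  "fibre_maps A B d = {f \<in> A \<rightarrow>\<^sub>E B. \<forall>i\<in>B. card {x \<in> A. f x = i} = d i}"

lemma funs_deg_eq_fibre_maps: "funs_deg n d = fibre_maps {1..n} {1..n} d"
  by (simp add: funs_deg_def fibre_maps_def)

lemma finite_fibre_maps: "finite A \<Longrightarrow> finite B \<Longrightarrow> finite (fibre_maps A B d)"
  unfolding fibre_maps_def by (rule finite_subset[OF _ finite_PiE[of A "\<lambda>_. B"]]) auto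

text \<open>Revealing \<open>f a = b\<close> uses up one unit of the degree of \<open>b\<close>, and
  \<open>g(a := b)\<close> inverts the restriction to \<open>A - {a}\<close>. \<open>Q\<close>
  stands for any event about the values not yet revealed. For \<open>d b = 0\<close> the truncated
  \<open>d b - 1\<close> would not record the lost unit, so that case is separate.\<close>

lemma card_fibre_maps_fixed_value:
  assumes A: "finite A" and a: "a \<in> A" and b: "b \<in> B"
  shows "card {f \<in> fibre_maps A B d. f a = b \<and> Q (restrict f (A - {a}))}
    = (if d b = 0 then 0
       else card {g \<in> fibre_maps (A - {a}) B (d(b := d b - 1)). Q g})"
proof (cases "d b = 0")
  case True
  have "{f \<in> fibre_maps A B d. f a = b \<and> Q (restrict f (A - {a}))} = {}"
  proof (rule ccontr)
    assume "\<not> ?thesis"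
    then obtain f where "f \<in> fibre_maps A B d" "f a = b" by blast
    then have "card {x \<in> A. f x = b} = 0" "a \<in> {x \<in> A. f x = b}" "finite {x \<in> A. f x = b}"
      using True a b A by (auto simp: fibre_maps_def)
    then show False by (metis card_eq_0_iff empty_iff)
  qed
  then show ?thesis using True by (simp only: card.empty) simp
next
  case False
  have card_split: "card {x \<in> A. f x = i} = card {x \<in> A - {a}. f x = i} + (if f a = i then 1 else 0)"
    for f :: "'a \<Rightarrow> 'b" and i
  proof (cases "f a = i")
    case True
    then have "{x \<in> A. f x = i} = insert a {x \<in> A - {a}. f x = i}" using a by auto
    then show ?thesis using True A by simp
  next
    case False
    then have "{x \<in> A. f x = i} = {x \<in> A - {a}. f x = i}" by auto
    then show ?thesis using False by simp
  qed
  have "bij_betw (\<lambda>f. restrict f (A - {a}))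
      {f \<in> fibre_maps A B d. f a = b \<and> Q (restrict f (A - {a}))}
      {g \<in> fibre_maps (A - {a}) B (d(b := d b - 1)). Q g}"
  proof (rule bij_betw_byWitness[where f' = "\<lambda>g. g(a := b)"])
    show "\<forall>f\<in>{f \<in> fibre_maps A B d. f a = b \<and> Q (restrict f (A - {a}))}.
        (restrict f (A - {a}))(a := b) = f"
      by (auto simp: fibre_maps_def fun_eq_iff PiE_def extensional_def)
    show inv: "\<forall>g\<in>{g \<in> fibre_maps (A - {a}) B (d(b := d b - 1)). Q g}.
        restrict (g(a := b)) (A - {a}) = g"
      by (auto simp: fibre_maps_def fun_eq_iff PiE_def extensional_def restrict_def)
    show "(\<lambda>f. restrict f (A - {a})) ` {f \<in> fibre_maps A B d. f a = b \<and> Q (restrict f (A - {a}))}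
      \<subseteq> {g \<in> fibre_maps (A - {a}) B (d(b := d b - 1)). Q g}"
    proof (rule image_subsetI)
      fix f assume "f \<in> {f \<in> fibre_maps A B d. f a = b \<and> Q (restrict f (A - {a}))}"
      then have f: "f \<in> A \<rightarrow>\<^sub>E B" "\<And>i. i \<in> B \<Longrightarrow> card {x \<in> A. f x = i} = d i"
        "f a = b" "Q (restrict f (A - {a}))" by (auto simp: fibre_maps_def)
      have "card {x \<in> A - {a}. restrict f (A - {a}) x = i} = (d(b := d b - 1)) i" if "i \<in> B" for i
      proof -
        have eq: "card {x \<in> A - {a}. restrict f (A - {a}) x = i} = card {x \<in> A - {a}. f x = i}"
          by (rule arg_cong[where f = card]) auto
        have "d i = card {x \<in> A - {a}. f x = i} + (if b = i then 1 else 0)"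
          using card_split[of f i] unfolding f(2)[OF that] f(3) .
        then show ?thesis unfolding eq by (cases "b = i") simp_all
      qed
      moreover have "restrict f (A - {a}) \<in> (A - {a}) \<rightarrow>\<^sub>E B" using f(1) by auto
      ultimately show "restrict f (A - {a}) \<in> {g \<in> fibre_maps (A - {a}) B (d(b := d b - 1)). Q g}"
        using f(4) by (simp add: fibre_maps_def)
    qed
    show "(\<lambda>g. g(a := b)) ` {g \<in> fibre_maps (A - {a}) B (d(b := d b - 1)). Q g}
      \<subseteq> {f \<in> fibre_maps A B d. f a = b \<and> Q (restrict f (A - {a}))}"
    proof (rule image_subsetI)
      fix g assume g: "g \<in> {g \<in> fibre_maps (A - {a}) B (d(b := d b - 1)). Q g}"
      then have g': "g \<in> (A - {a}) \<rightarrow>\<^sub>E B"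
        "\<And>i. i \<in> B \<Longrightarrow> card {x \<in> A - {a}. g x = i} = (d(b := d b - 1)) i"
        by (simp_all add: fibre_maps_def)
      have "card {x \<in> A. (g(a := b)) x = i} = d i" if "i \<in> B" for i
      proof -
        have "card {x \<in> A - {a}. (g(a := b)) x = i} = card {x \<in> A - {a}. g x = i}"
          by (rule arg_cong[where f = card]) auto
        then have "card {x \<in> A. (g(a := b)) x = i} = (d(b := d b - 1)) i + (if b = i then 1 else 0)"
          unfolding card_split[of "g(a := b)" i] g'(2)[OF that] by simp
        then show ?thesis using False by (cases "b = i") simp_all
      qed
      moreover have "g(a := b) \<in> A \<rightarrow>\<^sub>E B"
        using g'(1) a b by (auto simp: PiE_def extensional_def Pi_def)
      ultimately have "g(a := b) \<in> fibre_maps A B d" by (simp add: fibre_maps_def)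
      then show "g(a := b) \<in> {f \<in> fibre_maps A B d. f a = b \<and> Q (restrict f (A - {a}))}"
        using inv g by simp
    qed
  qed
  then show ?thesis using False by (simp add: bij_betw_same_card)
qed

lemma prod_fact_fun_upd:
  fixes d :: "'b \<Rightarrow> nat"
  assumes "finite B" "b \<in> B" "d b \<noteq> 0"
  shows "(\<Prod>i\<in>B. fact (d i) :: nat) = d b * (\<Prod>i\<in>B. fact ((d(b := d b - 1)) i))"
proof -
  have "(\<Prod>i\<in>B. fact (d i) :: nat) = fact (d b) * (\<Prod>i\<in>B - {b}. fact (d i))"
    using assms by (simp add: prod.remove)
  also have "fact (d b) = d b * fact (d b - 1)"
    using assms(3) by (simp add: fact_reduce)
  also have "(\<Prod>i\<in>B - {b}. fact (d i) :: nat) = (\<Prod>i\<in>B - {b}. fact ((d(b := d b - 1)) i))"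
    by (rule prod.cong) auto
  finally show ?thesis using assms by (simp add: prod.remove[of B b])
qed

lemma sum_fun_upd_pred:
  fixes d :: "'b \<Rightarrow> nat"
  assumes "finite B" "b \<in> B" "d b \<noteq> 0"
  shows "(\<Sum>i\<in>B. (d(b := d b - 1)) i) = (\<Sum>i\<in>B. d i) - 1"
proof -
  have "(\<Sum>i\<in>B - {b}. (d(b := d b - 1)) i) = (\<Sum>i\<in>B - {b}. d i)"
    by (rule sum.cong) auto
  then show ?thesis using assms by (simp add: sum.remove[of B b])
qed

text \<open>Sum over the revealed value \<open>b\<close>. Weighting counts by the product of
  factorials makes each term carry exactly the factor \<open>d b\<close>, since
  \<open>fact (d b) = d b * fact (d b - 1)\<close>; this factor also absorbs the case
  \<open>d b = 0\<close>.\<close>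

lemma card_fibre_maps_split:
  assumes A: "finite A" and B: "finite B" and a: "a \<in> A" and C: "C \<subseteq> B"
  shows "card {f \<in> fibre_maps A B d. f a \<in> C \<and> Q (f a) (restrict f (A - {a}))} * (\<Prod>i\<in>B. fact (d i))
    = (\<Sum>b\<in>C. d b * (card {g \<in> fibre_maps (A - {a}) B (d(b := d b - 1)). Q b g}
                     * (\<Prod>i\<in>B. fact ((d(b := d b - 1)) i))))"
proof -
  have C_fin: "finite C" using B C finite_subset by blast
  have "{f \<in> fibre_maps A B d. f a \<in> C \<and> Q (f a) (restrict f (A - {a}))}
    = (\<Union>b\<in>C. {f \<in> fibre_maps A B d. f a = b \<and> Q b (restrict f (A - {a}))})" by auto
  also have "card \<dots> = (\<Sum>b\<in>C. card {f \<in> fibre_maps A B d. f a = b \<and> Q b (restrict f (A - {a}))})"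
    by (rule card_UN_disjoint) (use C_fin finite_fibre_maps[OF A B] in auto)
  also have "\<dots> * (\<Prod>i\<in>B. fact (d i)) = (\<Sum>b\<in>C. d b * (card {g \<in> fibre_maps (A - {a}) B (d(b := d b - 1)). Q b g}
                     * (\<Prod>i\<in>B. fact ((d(b := d b - 1)) i))))"
    unfolding sum_distrib_right
  proof (rule sum.cong)
    fix b assume "b \<in> C"
    then have b: "b \<in> B" using C by auto
    show "card {f \<in> fibre_maps A B d. f a = b \<and> Q b (restrict f (A - {a}))} * (\<Prod>i\<in>B. fact (d i))
      = d b * (card {g \<in> fibre_maps (A - {a}) B (d(b := d b - 1)). Q b g}
                     * (\<Prod>i\<in>B. fact ((d(b := d b - 1)) i)))"
      unfolding card_fibre_maps_fixed_value[OF A a b, where Q = "Q b"]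
      by (cases "d b = 0") (simp_all add: prod_fact_fun_upd[OF B b, where d=d])
  qed simp
  finally show ?thesis .
qed

text \<open>The multinomial coefficient, in product form. Revealing one value gives the factor
  \<open>d b\<close> times the count for one point fewer, and the \<open>d b\<close> sum to
  \<open>card A\<close>.\<close>

lemma card_fibre_maps:
  assumes "finite A" "finite B" "(\<Sum>i\<in>B. d i) = card A"
  shows "card (fibre_maps A B d) * (\<Prod>i\<in>B. fact (d i)) = fact (card A)"
  using assms
proof (induction "card A" arbitrary: A d)
  case 0
  then have "fibre_maps A B d = {\<lambda>_. undefined}" "\<forall>i\<in>B. d i = 0"
    by (auto simp: fibre_maps_def)
  then show ?case using 0 by simp
next
  case (Suc m)
  obtain a where a: "a \<in> A" using Suc.hyps(2) by fastforce
  have m: "card (A - {a}) = m" using Suc a by simp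
  have "fibre_maps A B d = {f \<in> fibre_maps A B d. f a \<in> B \<and> True}"
    using a by (auto simp: fibre_maps_def)
  then have "card (fibre_maps A B d) * (\<Prod>i\<in>B. fact (d i))
      = (\<Sum>b\<in>B. d b * (card (fibre_maps (A - {a}) B (d(b := d b - 1)))
                     * (\<Prod>i\<in>B. fact ((d(b := d b - 1)) i))))"
    using card_fibre_maps_split[OF Suc.prems(1,2) a order_refl, of d "\<lambda>_ _. True"] by simp
  also have "\<dots> = (\<Sum>b\<in>B. d b * fact m)"
  proof (rule sum.cong)
    fix b assume b: "b \<in> B"
    show "d b * (card (fibre_maps (A - {a}) B (d(b := d b - 1)))
                     * (\<Prod>i\<in>B. fact ((d(b := d b - 1)) i))) = d b * fact m"
    proof (cases "d b = 0")
      case False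
      have s: "(\<Sum>i\<in>B. (d(b := d b - 1)) i) = card (A - {a})"
        using sum_fun_upd_pred[where d = d, OF Suc.prems(2) b False] Suc.prems(3) Suc.hyps(2) m by simp
      have "finite (A - {a})" using Suc.prems by simp
      from Suc.hyps(1)[OF m[symmetric] this Suc.prems(2) s] show ?thesis by (simp only: m)
    qed simp
  qed simp
  also have "\<dots> = fact (card A)"
    using Suc.prems(3) Suc.hyps(2)[symmetric] by (simp flip: sum_distrib_right)
  finally show ?case .
qed

section \<open>Walks without repeated vertices\<close>

text \<open>\<open>A\<close> holds the vertices whose values are still unrevealed, the current
  vertex \<open>u\<close> included. The recursion drops \<open>u\<close> from \<open>A\<close> at
  each step, just as the counting argument drops it from the domain.\<close>

fun fresh_walk :: "nat \<Rightarrow> 'a set \<Rightarrow> ('a \<Rightarrow> 'a) \<Rightarrow> 'a \<Rightarrow> bool" where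
  "fresh_walk 0 A f u \<longleftrightarrow> True"
| "fresh_walk (Suc k) A f u \<longleftrightarrow> f u \<in> A - {u} \<and> fresh_walk k (A - {u}) f (f u)"

text \<open>As long as the walk succeeds it stays inside \<open>A\<close>, so no value outside
  \<open>A\<close> is consulted. This lets \<open>f\<close> be replaced by its restriction to the
  unrevealed part.\<close>

lemma fresh_walk_cong:
  "u \<in> A \<Longrightarrow> (\<And>x. x \<in> A \<Longrightarrow> f x = g x) \<Longrightarrow> fresh_walk k A f u = fresh_walk k A g u"
proof (induction k arbitrary: A u)
  case (Suc k)
  show ?case
  proof (cases "f u \<in> A - {u}")
    case True
    then show ?thesis using Suc.IH[of "f u" "A - {u}"] Suc.prems by simp
  next
    case False
    then show ?thesis using Suc.prems by auto
  qed
qed simp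

lemma fresh_walk_iff:
  "u \<in> A \<Longrightarrow> fresh_walk k A f u \<longleftrightarrow> inj_on (\<lambda>i. (f ^^ i) u) {..k} \<and> (\<forall>i\<le>k. (f ^^ i) u \<in> A)"
proof (induction k arbitrary: A u)
  case (Suc k)
  have dec: "{..Suc k} = insert 0 (Suc ` {..k})"
    by (simp add: atMost_Suc_eq_insert_0)
  have shift: "(f ^^ Suc i) u = (f ^^ i) (f u)" for i
    by (simp only: funpow_Suc_right o_apply)
  have inj: "inj_on (\<lambda>i. (f ^^ i) u) (Suc ` {..k}) \<longleftrightarrow> inj_on (\<lambda>i. (f ^^ i) (f u)) {..k}"
    by (simp add: inj_on_def shift del: funpow.simps)
  have all: "(\<forall>i\<le>Suc k. P i) \<longleftrightarrow> P 0 \<and> (\<forall>i\<le>k. P (Suc i))" for P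
    by (metis Suc_le_mono le0 not0_implies_Suc)
  show ?case
  proof (cases "f u \<in> A - {u}")
    case True
    have "fresh_walk (Suc k) A f u \<longleftrightarrow>
        inj_on (\<lambda>i. (f ^^ i) (f u)) {..k} \<and> (\<forall>i\<le>k. (f ^^ i) (f u) \<in> A - {u})"
      using Suc.IH[of "f u" "A - {u}"] True by simp
    moreover have "inj_on (\<lambda>i. (f ^^ i) u) {..Suc k} \<longleftrightarrow>
       (\<forall>i\<le>k. (f ^^ i) (f u) \<noteq> u) \<and> inj_on (\<lambda>i. (f ^^ i) (f u)) {..k}"
    proof -
      have "u \<notin> (\<lambda>i. (f ^^ i) u) ` Suc ` {..k} \<longleftrightarrow> (\<forall>i\<le>k. (f ^^ i) (f u) \<noteq> u)"
        unfolding image_image shift image_iff by (metis atMost_iff)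
      moreover have "Suc ` {..k} - {0} = Suc ` {..k}" by auto
      ultimately show ?thesis unfolding dec inj_on_insert inj by auto
    qed
    ultimately show ?thesis using Suc.prems
      unfolding all by (auto simp: shift simp del: funpow.simps(2))
  next
    case False
    have "\<not> (inj_on (\<lambda>i. (f ^^ i) u) {..Suc k} \<and> (\<forall>i\<le>Suc k. (f ^^ i) u \<in> A))"
    proof
      assume *: "inj_on (\<lambda>i. (f ^^ i) u) {..Suc k} \<and> (\<forall>i\<le>Suc k. (f ^^ i) u \<in> A)"
      have "(f ^^ 1) u \<noteq> (f ^^ 0) u" using inj_onD[of _ "{..Suc k}" 1 0] * by fastforce
      then show False using * False by (auto simp: all)
    qed
    moreover have "\<not> fresh_walk (Suc k) A f u" using False by simp
    ultimately show ?thesis by blast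
  qed
qed simp

text \<open>The six-length is the first index at which an earlier iterate recurs, so it exceeds
  \<open>k\<close> exactly when the iterates \<open>0\<close> to \<open>k\<close> are
  distinct.\<close>

lemma less_six_length_iff:
  assumes A: "finite A" and u: "u \<in> A" and f: "\<And>x. x \<in> A \<Longrightarrow> f x \<in> A"
  shows "k < six_length f u \<longleftrightarrow> fresh_walk k A f u"
proof -
  have orbit: "(f ^^ i) u \<in> A" for i by (induction i) (use u f in auto)
  let ?P = "\<lambda>k. 1 \<le> k \<and> (f ^^ k) u \<in> {(f ^^ j) u | j. j \<le> k - 1}"
  \<comment> \<open>By pigeonhole some iterate recurs, so the \<open>LEAST\<close> in
    \<open>six_length\<close> is attained.\<close>
  have "\<exists>k. ?P k"
  proof -
    have "\<not> inj_on (\<lambda>i. (f ^^ i) u) {..card A}"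
    proof
      assume "inj_on (\<lambda>i. (f ^^ i) u) {..card A}"
      then have "card {..card A} \<le> card A"
        by (rule card_inj_on_le) (use orbit A in auto)
      then show False by simp
    qed
    then obtain i j where "(f ^^ i) u = (f ^^ j) u" "i \<noteq> j" by (auto simp: inj_on_def)
    then obtain i j where "(f ^^ i) u = (f ^^ j) u" "i < j" by (metis linorder_neqE_nat)
    then have "?P j" by (auto intro!: exI[of _ i])
    then show ?thesis ..
  qed
  then have P: "?P (six_length f u)" unfolding six_length_def by (rule LeastI_ex)
  have least: "\<not> ?P m" if "m < six_length f u" for m
    using not_less_Least that unfolding six_length_def by blast
  have "k < six_length f u \<longleftrightarrow> inj_on (\<lambda>i. (f ^^ i) u) {..k}"
  proof
    assume k: "k < six_length f u"
    have neq: "(f ^^ i) u \<noteq> (f ^^ j) u" if ij: "i < j" "j \<le> k" for i j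
    proof
      assume "(f ^^ i) u = (f ^^ j) u"
      then have "?P j" using ij by (auto intro!: exI[of _ i])
      moreover have "j < six_length f u" using ij k by simp
      ultimately show False using least by blast
    qed
    show "inj_on (\<lambda>i. (f ^^ i) u) {..k}"
    proof (rule inj_onI)
      fix i j assume "i \<in> {..k}" "j \<in> {..k}" "(f ^^ i) u = (f ^^ j) u"
      then show "i = j" using neq[of i j] neq[of j i] by (cases i j rule: linorder_cases) auto
    qed
  next
    assume inj: "inj_on (\<lambda>i. (f ^^ i) u) {..k}"
    show "k < six_length f u"
    proof (rule ccontr)
      assume "\<not> k < six_length f u"
      moreover from P obtain j where "(f ^^ six_length f u) u = (f ^^ j) u" "j < six_length f u"
        by force
      ultimately show False using inj_onD[OF inj, of "six_length f u" j] by simp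
    qed
  qed
  then show ?thesis using fresh_walk_iff[OF u, of k f] orbit by simp
qed

text \<open>Induction along the walk: the first step to \<open>b\<close> contributes
  \<open>d b\<close> and leaves a walk from \<open>b\<close> on \<open>A - {u}\<close>. Summing over
  \<open>b\<close> raises \<open>esym k\<close> to \<open>esym (Suc k)\<close> with the factor
  \<open>Suc k\<close>, which builds up \<open>fact k\<close>.\<close>

lemma card_fibre_maps_fresh_walk:
  assumes "finite B" "A \<subseteq> B" "(\<Sum>i\<in>B. d i) = card A" "u \<in> A"
  shows "card {f \<in> fibre_maps A B d. fresh_walk k A f u} * (\<Prod>i\<in>B. fact (d i))
    = fact (card A - k) * fact k * esym k (A - {u}) d"
  using assms
proof (induction k arbitrary: A d u)
  case 0
  have "finite A" using 0 finite_subset by blast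
  then show ?case using card_fibre_maps[of A B d] 0 by (simp add: esym_0)
next
  case (Suc k)
  let ?A = "A - {u}"
  have A: "finite A" using Suc.prems finite_subset by blast
  have "{f \<in> fibre_maps A B d. fresh_walk (Suc k) A f u}
    = {f \<in> fibre_maps A B d. f u \<in> ?A \<and> fresh_walk k ?A (restrict f ?A) (f u)}"
  proof -
    have "fresh_walk k ?A f (f u) = fresh_walk k ?A (restrict f ?A) (f u)" if "f u \<in> ?A" for f
      by (rule fresh_walk_cong) (use that in auto)
    then show ?thesis by auto
  qed
  moreover have AB: "?A \<subseteq> B" using Suc.prems(2) by auto
  ultimately have "card {f \<in> fibre_maps A B d. fresh_walk (Suc k) A f u} * (\<Prod>i\<in>B. fact (d i))
     = (\<Sum>b\<in>?A. d b * (card {g \<in> fibre_maps ?A B (d(b := d b - 1)). fresh_walk k ?A g b}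
                     * (\<Prod>i\<in>B. fact ((d(b := d b - 1)) i))))"
    using card_fibre_maps_split[where Q = "\<lambda>b g. fresh_walk k ?A g b" and d = d, OF A Suc.prems(1,4) AB]
    by (simp only:)
  also have "\<dots> = (\<Sum>b\<in>?A. d b * (fact (card A - Suc k) * fact k * esym k (?A - {b}) d))"
  proof (rule sum.cong)
    fix b assume b: "b \<in> ?A"
    show "d b * (card {g \<in> fibre_maps ?A B (d(b := d b - 1)). fresh_walk k ?A g b}
                     * (\<Prod>i\<in>B. fact ((d(b := d b - 1)) i)))
        = d b * (fact (card A - Suc k) * fact k * esym k (?A - {b}) d)"
    proof (cases "d b = 0")
      case False
      have bB: "b \<in> B" using b Suc.prems(2) by auto
      have cA: "card ?A = card A - 1" using A Suc.prems(4) by simp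
      have s: "(\<Sum>i\<in>B. (d(b := d b - 1)) i) = card ?A"
        using sum_fun_upd_pred[where d = d, OF Suc.prems(1) bB False] Suc.prems(3) cA by simp
      \<comment> \<open>The remaining walk never returns to \<open>b\<close>, so the lowered degree
        of \<open>b\<close> does not enter.\<close>
      have e: "esym k (?A - {b}) (d(b := d b - 1)) = esym k (?A - {b}) d"
        by (rule esym_cong) auto
      have c: "card ?A - k = card A - Suc k" using cA by simp
      have "card {g \<in> fibre_maps ?A B (d(b := d b - 1)). fresh_walk k ?A g b}
                     * (\<Prod>i\<in>B. fact ((d(b := d b - 1)) i))
          = fact (card ?A - k) * fact k * esym k (?A - {b}) (d(b := d b - 1))"
        by (rule Suc.IH[OF Suc.prems(1) AB s b])
      then show ?thesis by (simp only: e c)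
    qed simp
  qed simp
  also have "\<dots> = fact (card A - Suc k) * fact k * (\<Sum>b\<in>?A. d b * esym k (?A - {b}) d)"
    by (simp add: sum_distrib_left mult_ac)
  also have "(\<Sum>b\<in>?A. d b * esym k (?A - {b}) d) = Suc k * esym (Suc k) ?A d"
    using sum_esym_remove[of ?A d k] A by simp
  finally show ?case by (simp only: fact_Suc of_nat_id mult_ac)
qed

subsection \<open>Averages against Bernstein polynomials\<close>

text \<open>\<open>Bernstein n k t\<close> is the probability that a binomial variable with
  parameters \<open>n\<close> and \<open>t\<close> equals \<open>k\<close>. This is Chebyshev's
  inequality with the variance \<open>n * t * (1 - t)\<close> bounded by
  \<open>n * t\<close>.\<close>

lemma sum_Bernstein_chebyshev:
  assumes t: "0 \<le> t" "t \<le> 1" and e: "e > 0"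
  shows "(\<Sum>k | k \<le> n \<and> e \<le> \<bar>real k - real n * t\<bar>. Bernstein n k t) \<le> real n * t / e\<^sup>2"
proof -
  let ?I = "{k. k \<le> n \<and> e \<le> \<bar>real k - real n * t\<bar>}"
  have "(\<Sum>k\<in>?I. Bernstein n k t) \<le> (\<Sum>k\<in>?I. (real k - real n * t)\<^sup>2 / e\<^sup>2 * Bernstein n k t)"
  proof (rule sum_mono)
    fix k assume "k \<in> ?I"
    then have "e\<^sup>2 \<le> (real k - real n * t)\<^sup>2"
      using e abs_le_square_iff[of e "real k - real n * t"] by simp
    then have "1 \<le> (real k - real n * t)\<^sup>2 / e\<^sup>2" using e by simp
    from mult_right_mono[OF this Bernstein_nonneg[OF t, of n k]]
    show "Bernstein n k t \<le> (real k - real n * t)\<^sup>2 / e\<^sup>2 * Bernstein n k t"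
      by simp
  qed
  also have "\<dots> \<le> (\<Sum>k\<le>n. (real k - real n * t)\<^sup>2 / e\<^sup>2 * Bernstein n k t)"
    by (rule sum_mono2) (use Bernstein_nonneg[OF t] in auto)
  \<comment> \<open>The square is rewritten through \<open>k * (k - 1)\<close>, \<open>k\<close> and
    \<open>1\<close>, whose Bernstein averages have closed forms.\<close>
  also have "\<dots> = ((\<Sum>k\<le>n. real k * (real k - 1) * Bernstein n k t)
       + (1 - 2 * (real n * t)) * (\<Sum>k\<le>n. real k * Bernstein n k t)
       + (real n * t)\<^sup>2 * (\<Sum>k\<le>n. Bernstein n k t)) / e\<^sup>2"
    unfolding sum_distrib_left sum.distrib[symmetric] sum_divide_distrib
    by (intro sum.cong refl) (simp add: field_simps power2_eq_square)
  also have "\<dots> = real n * t * (1 - t) / e\<^sup>2"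
    unfolding sum_k_Bernstein sum_kk_Bernstein sum_Bernstein
    by (simp add: algebra_simps power2_eq_square)
  also have "\<dots> \<le> real n * t / e\<^sup>2"
  proof (rule divide_right_mono)
    show "real n * t * (1 - t) \<le> real n * t"
      using t mult_left_mono[of "1 - t" 1 "real n * t"] by simp
  qed simp
  finally show ?thesis .
qed

text \<open>Markov's inequality for the same binomial variable, whose mean is
  \<open>n * t\<close>.\<close>

lemma sum_Bernstein_markov:
  assumes t: "0 \<le> t" "t \<le> 1" and a: "a > 0"
  shows "(\<Sum>k | k \<le> n \<and> a \<le> real k. Bernstein n k t) \<le> real n * t / a"
proof -
  let ?I = "{k. k \<le> n \<and> a \<le> real k}"
  have "(\<Sum>k\<in>?I. Bernstein n k t) \<le> (\<Sum>k\<in>?I. real k / a * Bernstein n k t)"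
  proof (rule sum_mono)
    fix k assume "k \<in> ?I"
    then have "1 \<le> real k / a" using a by simp
    from mult_right_mono[OF this Bernstein_nonneg[OF t, of n k]]
    show "Bernstein n k t \<le> real k / a * Bernstein n k t"
      by simp
  qed
  also have "\<dots> \<le> (\<Sum>k\<le>n. real k / a * Bernstein n k t)"
    by (rule sum_mono2) (use Bernstein_nonneg[OF t] a in auto)
  also have "\<dots> = (\<Sum>k\<le>n. real k * Bernstein n k t) / a"
    by (simp only: sum_divide_distrib times_divide_eq_left)
  finally show ?thesis by simp
qed

text \<open>For binomial \<open>N\<close>, the event \<open>N \<le> a\<close> gives
  \<open>q N \<ge> q a\<close>; the rest of the average is nonnegative.\<close>

lemma antimono_le_Bernstein_average:
  fixes q :: "real \<Rightarrow> real"
  assumes q: "antimono q" "\<And>y. 0 \<le> q y" and t: "0 \<le> t" "t \<le> 1"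
  shows "q a * (1 - (\<Sum>k | k \<le> n \<and> a < real k. Bernstein n k t)) \<le> (\<Sum>k\<le>n. q (real k) * Bernstein n k t)"
proof -
  have split: "{..n} = {k. k \<le> n \<and> real k \<le> a} \<union> {k. k \<le> n \<and> a < real k}" by auto
  have "(\<Sum>k\<le>n. Bernstein n k t) = (\<Sum>k | k \<le> n \<and> real k \<le> a. Bernstein n k t)
      + (\<Sum>k | k \<le> n \<and> a < real k. Bernstein n k t)"
    unfolding split by (rule sum.union_disjoint) auto
  then have "1 - (\<Sum>k | k \<le> n \<and> a < real k. Bernstein n k t)
      = (\<Sum>k | k \<le> n \<and> real k \<le> a. Bernstein n k t)" by simp
  then have "q a * (1 - (\<Sum>k | k \<le> n \<and> a < real k. Bernstein n k t))
      = (\<Sum>k | k \<le> n \<and> real k \<le> a. q a * Bernstein n k t)"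
    by (simp only: sum_distrib_left)
  also have "\<dots> \<le> (\<Sum>k | k \<le> n \<and> real k \<le> a. q (real k) * Bernstein n k t)"
    by (rule sum_mono) (use Bernstein_nonneg[OF t] q antimonoD[OF q(1)] in \<open>auto intro!: mult_right_mono\<close>)
  also have "\<dots> \<le> (\<Sum>k\<le>n. q (real k) * Bernstein n k t)"
    by (rule sum_mono2) (use Bernstein_nonneg[OF t] q in auto)
  finally show ?thesis .
qed

text \<open>Here \<open>q N \<le> q a\<close> on the event \<open>N \<ge> a\<close>, and
  \<open>q N \<le> 1\<close> is used on its complement.\<close>

lemma Bernstein_average_le_antimono:
  fixes q :: "real \<Rightarrow> real"
  assumes q: "antimono q" "\<And>y. 0 \<le> q y" "\<And>y. q y \<le> 1" and t: "0 \<le> t" "t \<le> 1"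
  shows "(\<Sum>k\<le>n. q (real k) * Bernstein n k t) \<le> q a + (\<Sum>k | k \<le> n \<and> real k < a. Bernstein n k t)"
proof -
  have split: "{..n} = {k. k \<le> n \<and> a \<le> real k} \<union> {k. k \<le> n \<and> real k < a}" by auto
  have "(\<Sum>k\<le>n. q (real k) * Bernstein n k t) = (\<Sum>k | k \<le> n \<and> a \<le> real k. q (real k) * Bernstein n k t)
      + (\<Sum>k | k \<le> n \<and> real k < a. q (real k) * Bernstein n k t)"
    unfolding split by (rule sum.union_disjoint) auto
  also have "(\<Sum>k | k \<le> n \<and> a \<le> real k. q (real k) * Bernstein n k t)
       \<le> (\<Sum>k | k \<le> n \<and> a \<le> real k. q a * Bernstein n k t)"
    by (rule sum_mono) (use Bernstein_nonneg[OF t] antimonoD[OF q(1)] in \<open>auto intro!: mult_right_mono\<close>)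
  also have "\<dots> \<le> (\<Sum>k\<le>n. q a * Bernstein n k t)"
    by (rule sum_mono2) (use Bernstein_nonneg[OF t] q in auto)
  also have "\<dots> = q a" by (simp flip: sum_distrib_left)
  also have "(\<Sum>k | k \<le> n \<and> real k < a. q (real k) * Bernstein n k t)
      \<le> (\<Sum>k | k \<le> n \<and> real k < a. Bernstein n k t)"
    by (rule sum_mono) (use Bernstein_nonneg[OF t] q(3) in \<open>auto intro!: mult_left_le_one_le q(2)\<close>)
  finally show ?thesis by simp
qed

subsection \<open>The survival function of the six-length\<close>

text \<open>The argument is real so that rescaled lengths can be inserted and monotonicity holds on
  the whole line.\<close>

definition survival :: "nat \<Rightarrow> (nat \<Rightarrow> nat) \<Rightarrow> nat \<Rightarrow> real \<Rightarrow> real" where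
  "survival n d v y = exp_six n d v (\<lambda>s. if y < real s then 1 else 0)"

lemma finite_funs_deg: "finite (funs_deg n d)"
  by (simp add: funs_deg_eq_fibre_maps finite_fibre_maps)

lemma card_funs_deg:
  assumes "is_degree_seq n d"
  shows "card (funs_deg n d) * (\<Prod>i\<in>{1..n}. fact (d i)) = fact n"
proof -
  have c: "card {1..n} = n" by simp
  have "card (fibre_maps {1..n} {1..n} d) * (\<Prod>i\<in>{1..n}. fact (d i)) = fact (card {1..n})"
    by (rule card_fibre_maps) (use assms in \<open>simp_all add: is_degree_seq_def\<close>)
  then show ?thesis by (simp only: c funs_deg_eq_fibre_maps)
qed

lemma survival_eq: "survival n d v y = card {f \<in> funs_deg n d. y < real (six_length f v)} / card (funs_deg n d)"
  by (simp add: survival_def exp_six_def sum.If_cases finite_funs_deg Int_def)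

lemma survival_nonneg: "0 \<le> survival n d v y"
  by (simp add: survival_eq)

lemma survival_le_1: "survival n d v y \<le> 1"
proof -
  have "card {f \<in> funs_deg n d. y < real (six_length f v)} \<le> card (funs_deg n d)"
    by (rule card_mono) (auto simp: finite_funs_deg)
  then show ?thesis by (cases "card (funs_deg n d) = 0") (simp_all add: survival_eq)
qed

lemma antimono_survival: "antimono (survival n d v)"
proof (rule antimonoI)
  fix x y :: real assume "x \<le> y"
  then have "card {f \<in> funs_deg n d. y < real (six_length f v)}
      \<le> card {f \<in> funs_deg n d. x < real (six_length f v)}"
    by (intro card_mono) (auto simp: finite_funs_deg)
  then show "survival n d v y \<le> survival n d v x"
    by (simp add: survival_eq divide_right_mono)
qed

text \<open>In the ratio of the two counts the factorials of the degrees cancel, and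
  \<open>fact k * fact (n - k) / fact n\<close> is the inverse binomial coefficient.\<close>

lemma survival_of_nat:
  assumes d: "is_degree_seq n d" and v: "v \<in> {1..n}" and k: "k \<le> n"
  shows "survival n d v (real k) * real (n choose k) = esym k ({1..n} - {v}) (\<lambda>j. real (d j))"
proof -
  let ?P = "\<Prod>i\<in>{1..n}. fact (d i) :: nat"
  have "{f \<in> funs_deg n d. real k < real (six_length f v)}
      = {f \<in> fibre_maps {1..n} {1..n} d. fresh_walk k {1..n} f v}"
  proof -
    have "k < six_length f v \<longleftrightarrow> fresh_walk k {1..n} f v" if "f \<in> fibre_maps {1..n} {1..n} d" for f
      by (rule less_six_length_iff) (use that v in \<open>auto simp: fibre_maps_def\<close>)
    then show ?thesis by (auto simp: funs_deg_eq_fibre_maps)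
  qed
  then have "card {f \<in> funs_deg n d. real k < real (six_length f v)} * ?P
      = fact (n - k) * fact k * esym k ({1..n} - {v}) d"
    using card_fibre_maps_fresh_walk[of "{1..n}" "{1..n}" d v k] d v
    by (simp only: is_degree_seq_def finite_atLeastAtMost card_atLeastAtMost order_refl diff_Suc_1 Suc_eq_plus1[symmetric])
  from arg_cong[where f = real, OF this] have num: "real (card {f \<in> funs_deg n d. real k < real (six_length f v)}) * real ?P
      = fact (n - k) * fact k * esym k ({1..n} - {v}) (\<lambda>j. real (d j))"
    by (simp only: of_nat_mult of_nat_fact of_nat_esym)
  have den: "real (card (funs_deg n d)) * real ?P = fact n"
    using arg_cong[where f = real, OF card_funs_deg[OF d]] by (simp only: of_nat_mult of_nat_fact)
  have P: "real ?P > 0" by (simp add: prod_pos)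
  have "survival n d v (real k) = (real (card {f \<in> funs_deg n d. real k < real (six_length f v)}) * real ?P)
      / (real (card (funs_deg n d)) * real ?P)"
    unfolding survival_eq using P by simp
  also have "\<dots> = fact (n - k) * fact k * esym k ({1..n} - {v}) (\<lambda>j. real (d j)) / fact n"
    by (simp only: num den)
  finally show ?thesis unfolding binomial_fact[OF k, where 'a = real] by simp
qed

text \<open>Only \<open>n - 1\<close> vertices differ from \<open>v\<close>, so the symmetric
  polynomial of order \<open>n\<close> vanishes.\<close>

lemma survival_eq_0:
  assumes d: "is_degree_seq n d" and v: "v \<in> {1..n}" and y: "real n \<le> y"
  shows "survival n d v y = 0"
proof -
  have "card ({1..n} - {v}) < n" using v by auto
  then have "survival n d v (real n) = 0"
    using survival_of_nat[OF d v, of n] by (simp add: esym_eq_0)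
  then show ?thesis
    using antimonoD[OF antimono_survival y, of n d v] survival_nonneg[of n d v y] by simp
qed

text \<open>The binomial coefficient in the Bernstein weight cancels the one in the survival
  probability. There are only \<open>n - 1\<close> variables, hence the extra factor
  \<open>1 - t\<close>.\<close>

lemma Bernstein_average_survival:
  assumes d: "is_degree_seq n d" and v: "v \<in> {1..n}"
  shows "(\<Sum>k\<le>n. survival n d v (real k) * Bernstein n k t)
    = (1 - t) * (\<Prod>j\<in>{1..n} - {v}. 1 + (real (d j) - 1) * t)"
proof -
  let ?A = "{1..n} - {v}" and ?x = "\<lambda>j. real (d j)"
  obtain m where m: "n = Suc m" using v by (cases n) auto
  have A: "finite ?A" "card ?A = m" using v m by auto
  have "(\<Sum>k\<le>n. survival n d v (real k) * Bernstein n k t)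
      = (\<Sum>k\<le>n. esym k ?A ?x * t ^ k * (1 - t) ^ (n - k))"
  proof (rule sum.cong)
    fix k assume "k \<in> {..n}"
    then show "survival n d v (real k) * Bernstein n k t = esym k ?A ?x * t ^ k * (1 - t) ^ (n - k)"
      using survival_of_nat[OF d v, of k, symmetric] by (simp only: Bernstein_def atMost_iff mult_ac of_nat_eq_iff)
  qed simp
  also have "\<dots> = (\<Sum>k\<le>m. esym k ?A ?x * t ^ k * (1 - t) ^ (n - k))"
    using esym_eq_0[OF A(1), of n ?x] A(2) m by simp
  also have "\<dots> = (1 - t) * (\<Sum>k\<le>m. esym k ?A ?x * t ^ k * (1 - t) ^ (m - k))"
    unfolding sum_distrib_left by (rule sum.cong) (auto simp: m Suc_diff_le)
  also have "\<dots> = (1 - t) * (\<Prod>j\<in>?A. t * ?x j + (1 - t))"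
    using sum_esym_homogeneous[OF A(1), of ?x t "1 - t"] A(2) by simp
  also have "(\<Prod>j\<in>?A. t * ?x j + (1 - t)) = (\<Prod>j\<in>?A. 1 + (?x j - 1) * t)"
    by (rule prod.cong) (auto simp: algebra_simps)
  finally show ?thesis .
qed

section \<open>Comparing the survival function with its binomial average\<close>

definition walk_gf :: "nat \<Rightarrow> (nat \<Rightarrow> nat) \<Rightarrow> nat \<Rightarrow> real \<Rightarrow> real" where
  "walk_gf n d v t = (1 - t) * (\<Prod>j\<in>{1..n} - {v}. 1 + (real (d j) - 1) * t)"

text \<open>\<open>1 - t\<close> is at most the missing factor for \<open>v\<close>, because
  \<open>d v \<ge> 0\<close>. The full product is easier to handle: its centred degrees sum to
  \<open>0\<close>.\<close>

lemma walk_gf_le_prod: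
  assumes v: "v \<in> {1..n}" and t: "0 \<le> t" "t \<le> 1"
  shows "walk_gf n d v t \<le> (\<Prod>j\<in>{1..n}. 1 + (real (d j) - 1) * t)"
proof -
  have nn: "0 \<le> 1 + (real (d j) - 1) * t" for j
  proof -
    have "1 + (real (d j) - 1) * t = (1 - t) + real (d j) * t" by (simp add: algebra_simps)
    also have "0 \<le> \<dots>" using t by (intro add_nonneg_nonneg) auto
    finally show ?thesis .
  qed
  have "1 - t \<le> 1 + (real (d v) - 1) * t"
    using t by (simp add: algebra_simps)
  then have "walk_gf n d v t \<le> (1 + (real (d v) - 1) * t) * (\<Prod>j\<in>{1..n} - {v}. 1 + (real (d j) - 1) * t)"
    unfolding walk_gf_def using nn by (intro mult_right_mono prod_nonneg) auto
  then show ?thesis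
    using v by (subst prod.remove[of _ v]) auto
qed

lemma walk_gf_eq_prod:
  assumes v: "v \<in> {1..n}" and nz: "1 + (real (d v) - 1) * t \<noteq> 0"
  shows "walk_gf n d v t = (1 - t) / (1 + (real (d v) - 1) * t) * (\<Prod>j\<in>{1..n}. 1 + (real (d j) - 1) * t)"
  unfolding walk_gf_def using v nz by (subst (2) prod.remove[of _ v]) auto

text \<open>A binomial variable with mean \<open>a / 2\<close> exceeds \<open>a\<close> with
  probability at most \<open>1 / 2\<close>, by Markov. Unlike the Chebyshev comparisons, this has no
  additive error, as uniform tail bounds require.\<close>

lemma survival_le_walk_gf:
  assumes d: "is_degree_seq n d" and v: "v \<in> {1..n}" and a: "0 < a" "a \<le> real n"
  shows "survival n d v a \<le> 2 * walk_gf n d v (a / (2 * real n))"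
proof -
  let ?t = "a / (2 * real n)"
  have n: "real n > 0" using a by linarith
  have t: "0 \<le> ?t" "?t \<le> 1" using a n by (simp_all add: field_simps)
  have "(\<Sum>k | k \<le> n \<and> a < real k. Bernstein n k ?t) \<le> (\<Sum>k | k \<le> n \<and> a \<le> real k. Bernstein n k ?t)"
    by (rule sum_mono2) (use Bernstein_nonneg[OF t] in auto)
  also have "\<dots> \<le> real n * ?t / a" by (rule sum_Bernstein_markov[OF t a(1)])
  also have "\<dots> = 1 / 2" using n a by simp
  finally have "1 / 2 \<le> 1 - (\<Sum>k | k \<le> n \<and> a < real k. Bernstein n k ?t)" by simp
  from mult_left_mono[OF this survival_nonneg[of n d v a]]
  have "survival n d v a * (1 / 2) \<le> walk_gf n d v ?t"
    using antimono_le_Bernstein_average[OF antimono_survival survival_nonneg t, of n d v a n]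
    unfolding Bernstein_average_survival[OF d v] walk_gf_def by simp
  then show ?thesis by simp
qed

text \<open>A binomial variable with mean \<open>a\<close> exceeds \<open>a + e\<close> with
  probability at most \<open>a / e^2\<close>.\<close>

lemma survival_le_walk_gf_shift:
  assumes d: "is_degree_seq n d" and v: "v \<in> {1..n}" and a: "0 \<le> a" "a \<le> real n" and e: "e > 0"
  shows "survival n d v (a + e) \<le> walk_gf n d v (a / real n) + a / e\<^sup>2"
proof -
  let ?t = "a / real n"
  have n: "real n > 0" using v by simp
  have t: "0 \<le> ?t" "?t \<le> 1" using a n by (simp_all add: field_simps)
  let ?r = "\<Sum>k | k \<le> n \<and> a + e < real k. Bernstein n k ?t"
  have "?r \<le> (\<Sum>k | k \<le> n \<and> e \<le> \<bar>real k - real n * ?t\<bar>. Bernstein n k ?t)"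
    by (rule sum_mono2) (use Bernstein_nonneg[OF t] n in auto)
  also have "\<dots> \<le> real n * ?t / e\<^sup>2" by (rule sum_Bernstein_chebyshev[OF t e])
  finally have r: "?r \<le> a / e\<^sup>2" using n by simp
  have r0: "0 \<le> ?r" using Bernstein_nonneg[OF t] by (intro sum_nonneg) auto
  have "survival n d v (a + e) * (1 - ?r) \<le> walk_gf n d v ?t"
    using antimono_le_Bernstein_average[OF antimono_survival survival_nonneg t, of n d v "a + e" n]
    unfolding Bernstein_average_survival[OF d v] walk_gf_def by simp
  \<comment> \<open>Since survival is at most \<open>1\<close>, the multiplicative loss
    \<open>1 - ?r\<close> becomes an additive error.\<close>
  moreover have "survival n d v (a + e) * ?r \<le> 1 * ?r"
    using r0 survival_le_1 by (rule mult_right_mono[rotated])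
  ultimately show ?thesis using r by (simp add: algebra_simps)
qed

text \<open>The matching bound from the other side: the same variable falls below
  \<open>a - e\<close> with probability at most \<open>a / e^2\<close>.\<close>

lemma walk_gf_le_survival_shift:
  assumes d: "is_degree_seq n d" and v: "v \<in> {1..n}" and a: "0 \<le> a" "a \<le> real n" and e: "e > 0"
  shows "walk_gf n d v (a / real n) \<le> survival n d v (a - e) + a / e\<^sup>2"
proof -
  let ?t = "a / real n"
  have n: "real n > 0" using v by simp
  have t: "0 \<le> ?t" "?t \<le> 1" using a n by (simp_all add: field_simps)
  let ?r = "\<Sum>k | k \<le> n \<and> real k < a - e. Bernstein n k ?t"
  have "?r \<le> (\<Sum>k | k \<le> n \<and> e \<le> \<bar>real k - real n * ?t\<bar>. Bernstein n k ?t)"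
    by (rule sum_mono2) (use Bernstein_nonneg[OF t] n in auto)
  also have "\<dots> \<le> real n * ?t / e\<^sup>2" by (rule sum_Bernstein_chebyshev[OF t e])
  finally have r: "?r \<le> a / e\<^sup>2" using n by simp
  have "walk_gf n d v ?t \<le> survival n d v (a - e) + ?r"
    using Bernstein_average_le_antimono[OF antimono_survival survival_nonneg survival_le_1 t, of n d v n "a - e"]
    unfolding Bernstein_average_survival[OF d v] walk_gf_def by simp
  then show ?thesis using r by simp
qed

subsection \<open>Products of centred degrees\<close>

lemma ln_one_plus_quadratic:
  fixes e :: real
  assumes "e > 0"
  obtains \<delta> :: real where "0 < \<delta>" "\<delta> < 1"
    "\<And>u. \<bar>u\<bar> \<le> \<delta> \<Longrightarrow> \<bar>ln (1 + u) - u + u\<^sup>2 / 2\<bar> \<le> e * u\<^sup>2"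
proof -
  have "((\<lambda>u::real. (ln (1 + u) - u + u\<^sup>2 / 2) / u\<^sup>2) \<longlongrightarrow> 0) (at 0)"
    by real_asymp
  from tendstoD[OF this assms]
  have "\<forall>\<^sub>F u in at 0. \<bar>(ln (1 + u) - u + u\<^sup>2 / 2) / u\<^sup>2\<bar> < e"
    by (simp only: dist_real_def diff_0_right)
  then obtain r where r: "r > 0" "\<And>u. u \<noteq> 0 \<Longrightarrow> \<bar>u\<bar> < r \<Longrightarrow> \<bar>(ln (1 + u) - u + u\<^sup>2 / 2) / u\<^sup>2\<bar> < e"
    unfolding eventually_at by (auto simp: dist_real_def)
  show thesis
  proof (rule that[of "min (r/2) (1/2)"])
    fix u :: real assume u: "\<bar>u\<bar> \<le> min (r/2) (1/2)"
    show "\<bar>ln (1 + u) - u + u\<^sup>2 / 2\<bar> \<le> e * u\<^sup>2"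
    proof (cases "u = 0")
      case False
      then have "\<bar>ln (1 + u) - u + u\<^sup>2 / 2\<bar> / u\<^sup>2 < e" using r(2)[of u] r(1) u by simp
      then show ?thesis using False by (simp add: divide_less_eq)
    qed simp
  qed (use r(1) in auto)
qed

text \<open>Take logarithms and expand to second order: the linear terms cancel because the
  \<open>c j\<close> sum to \<open>0\<close>, and the errors add up to at most \<open>e\<close>
  times the sum of squares.\<close>

lemma prod_one_plus_bounds:
  fixes c :: "'a \<Rightarrow> real"
  assumes taylor: "\<And>u. \<bar>u\<bar> \<le> \<delta> \<Longrightarrow> \<bar>ln (1 + u) - u + u\<^sup>2 / 2\<bar> \<le> e * u\<^sup>2"
    and "\<delta> < 1" and A: "finite A" and c: "sum c A = 0" "\<And>j. j \<in> A \<Longrightarrow> \<bar>c j * t\<bar> \<le> \<delta>"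
  shows "exp (- (1/2 + e) * (t\<^sup>2 * (\<Sum>j\<in>A. (c j)\<^sup>2))) \<le> (\<Prod>j\<in>A. 1 + c j * t)"
    and "(\<Prod>j\<in>A. 1 + c j * t) \<le> exp (- (1/2 - e) * (t\<^sup>2 * (\<Sum>j\<in>A. (c j)\<^sup>2)))"
proof -
  have pos: "1 + c j * t > 0" if "j \<in> A" for j using c(2)[OF that] assms(2) by linarith
  have eq: "(\<Prod>j\<in>A. 1 + c j * t) = exp (\<Sum>j\<in>A. ln (1 + c j * t))"
    unfolding exp_sum[OF A] by (rule prod.cong) (use pos in auto)
  have id: "(\<Sum>j\<in>A. c j * t + b * (c j * t)\<^sup>2) = b * (t\<^sup>2 * (\<Sum>j\<in>A. (c j)\<^sup>2))" for b
  proof -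
    have "(\<Sum>j\<in>A. c j * t + b * (c j * t)\<^sup>2) = sum c A * t + b * (t\<^sup>2 * (\<Sum>j\<in>A. (c j)\<^sup>2))"
      unfolding sum_distrib_left sum_distrib_right sum.distrib[symmetric]
      by (rule sum.cong) (simp_all add: power_mult_distrib mult_ac)
    then show ?thesis using c(1) by simp
  qed
  have taylor': "c j * t + (- (1/2 + e)) * (c j * t)\<^sup>2 \<le> ln (1 + c j * t)"
    "ln (1 + c j * t) \<le> c j * t + (- (1/2 - e)) * (c j * t)\<^sup>2" if "j \<in> A" for j
    using taylor[OF c(2)[OF that]] by (auto simp: abs_le_iff algebra_simps)
  show "exp (- (1/2 + e) * (t\<^sup>2 * (\<Sum>j\<in>A. (c j)\<^sup>2))) \<le> (\<Prod>j\<in>A. 1 + c j * t)"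
    unfolding eq id[symmetric] exp_le_cancel_iff by (rule sum_mono) (rule taylor')
  show "(\<Prod>j\<in>A. 1 + c j * t) \<le> exp (- (1/2 - e) * (t\<^sup>2 * (\<Sum>j\<in>A. (c j)\<^sup>2)))"
    unfolding eq id[symmetric] exp_le_cancel_iff by (rule sum_mono) (rule taylor')
qed

lemma sum_centred_degrees:
  assumes "is_degree_seq n d"
  shows "(\<Sum>j\<in>{1..n}. real (d j) - 1) = 0"
proof -
  have "(\<Sum>j\<in>{1..n}. real (d j)) = real n"
    using assms unfolding is_degree_seq_def of_nat_sum[symmetric] by simp
  then show ?thesis by (simp add: sum_subtractf)
qed

lemma sum_centred_degrees_squared:
  assumes d: "is_degree_seq n d" and n: "n \<ge> 1"
  shows "(\<Sum>j\<in>{1..n}. (real (d j) - 1)\<^sup>2) = real n * sigma2 n d"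
proof -
  have "(\<Sum>j\<in>{1..n}. (real (d j) - 1)\<^sup>2)
      = (\<Sum>j\<in>{1..n}. real (d j ^ 2) - 2 * (real (d j) - 1) - 1)"
    by (rule sum.cong) (simp_all add: power2_eq_square algebra_simps)
  also have "\<dots> = (\<Sum>j\<in>{1..n}. real (d j ^ 2)) - 2 * (\<Sum>j\<in>{1..n}. real (d j) - 1) - real n"
    unfolding sum_subtractf[of _ "\<lambda>_. 1"] sum_subtractf[of _ "\<lambda>j. 2 * (real (d j) - 1)"]
      sum_distrib_left[symmetric] by simp
  also have "\<dots> = real (moment n d 2) - real n"
    unfolding sum_centred_degrees[OF d] by (simp add: moment_def)
  also have "\<dots> = real n * sigma2 n d" using n by (simp add: sigma2_def right_diff_distrib)
  finally show ?thesis .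
qed

lemma le_max_deg: "j \<in> {1..n} \<Longrightarrow> d j \<le> max_deg n d"
  by (simp add: max_deg_def)

lemma max_deg_ge_1:
  assumes "is_degree_seq n d" "n \<ge> 1"
  shows "1 \<le> max_deg n d"
proof (rule ccontr)
  assume "\<not> ?thesis"
  then have "\<And>j. j \<in> {1..n} \<Longrightarrow> d j = 0" using le_max_deg[of _ n d] by fastforce
  then have "(\<Sum>j\<in>{1..n}. d j) = 0" by simp
  then show False using assms by (simp add: is_degree_seq_def)
qed

text \<open>For \<open>d j = 0\<close> the left side is \<open>1\<close>, which is covered because
  the maximum degree is at least \<open>1\<close>.\<close>

lemma centred_degree_bound:
  assumes "is_degree_seq n d" "j \<in> {1..n}"
  shows "\<bar>real (d j) - 1\<bar> \<le> real (max_deg n d)"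
  using le_max_deg[OF assms(2), of d] max_deg_ge_1[OF assms(1)] assms(2) by auto

subsection \<open>Integral formulas for moments\<close>

lemma powr_le_exp: "0 < x \<Longrightarrow> 0 \<le> r \<Longrightarrow> x powr r \<le> exp (r * x)" for x r :: real
  using ln_bound[of x] by (simp add: powr_def mult_left_mono)

lemma has_bochner_integral_powr_deriv:
  fixes a p :: real
  assumes a: "0 \<le> a" and p: "1 \<le> p"
  shows "has_bochner_integral lborel (\<lambda>x. indicator {0<..<a} x * (p * x powr (p - 1))) (a powr p)"
proof (cases "a = 0")
  case True
  then show ?thesis using p by (simp add: has_bochner_integral_zero)
next
  case False
  then have a0: "0 < a" using a by simp
  have ein: "einterval 0 (ereal a) = {0<..<a}"
    by (auto simp: einterval_def zero_ereal_def)
  have lim0: "((\<lambda>x. x powr p) \<longlongrightarrow> 0) (at_right 0)"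
    using p by real_asymp
  have lima: "((\<lambda>x. x powr p) \<longlongrightarrow> a powr p) (at_left a)"
    using a0 by (intro tendsto_intros) auto
  have D: "DERIV (\<lambda>x. x powr p) x :> p * x powr (p - 1)" if "0 < ereal x" "ereal x < ereal a" for x
    using that by (auto intro!: derivative_eq_intros simp: zero_ereal_def)
  have cont: "isCont (\<lambda>x. p * x powr (p - 1)) x" if "0 < ereal x" "ereal x < ereal a" for x
    using that by (auto intro!: continuous_intros simp: zero_ereal_def)
  have N: "AE x in lborel. 0 < ereal x \<longrightarrow> ereal x < ereal a \<longrightarrow> 0 \<le> p * x powr (p - 1)"
    using p by simp
  have L: "(((\<lambda>x. x powr p) \<circ> real_of_ereal) \<longlongrightarrow> 0) (at_right 0)"
    using lim0 by (simp add: zero_ereal_def ereal_tendsto_simps1)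
  have R: "(((\<lambda>x. x powr p) \<circ> real_of_ereal) \<longlongrightarrow> a powr p) (at_left (ereal a))"
    using lima by (simp add: ereal_tendsto_simps1)
  have "(0::ereal) < ereal a" using a0 by simp
  note ftc = interval_integral_FTC_nonneg[OF this D cont N L R]
  show ?thesis
    using a0 ftc unfolding has_bochner_integral_iff set_integrable_def set_lebesgue_integral_def
      interval_lebesgue_integral_def ein
    by (simp add: zero_ereal_def)
qed

text \<open>Both \<open>x powr r\<close> and \<open>1 + x^2\<close> are at most exponentials in
  \<open>x\<close>; completing the square then bounds the exponent by a constant.\<close>

lemma powr_times_gaussian_le:
  fixes x r :: real
  assumes "0 < x" "0 \<le> r"
  shows "x powr r * exp (- x\<^sup>2 / 2) \<le> exp ((r + 2)\<^sup>2 / 2) * inverse (1 + x\<^sup>2)"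
proof -
  have "1 + x\<^sup>2 \<le> (1 + x)\<^sup>2" using assms by (simp add: power2_eq_square algebra_simps)
  also have "\<dots> \<le> (exp x)\<^sup>2" using assms exp_ge_add_one_self[of x] by (intro power_mono) auto
  also have "\<dots> = exp (2 * x)" by (simp flip: exp_double)
  finally have "(x powr r * (1 + x\<^sup>2)) * exp (- x\<^sup>2 / 2) \<le> (exp (r * x) * exp (2 * x)) * exp (- x\<^sup>2 / 2)"
    using powr_le_exp[OF assms] by (intro mult_mono) auto
  also have "\<dots> = exp (r * x + 2 * x - x\<^sup>2 / 2)" by (simp add: exp_add[symmetric])
  also have "\<dots> \<le> exp ((r + 2)\<^sup>2 / 2)"
  proof -
    have "0 \<le> (r + 2 - x)\<^sup>2" by simp
    then show ?thesis by (simp add: power2_eq_square algebra_simps)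
  qed
  finally have "(x powr r * exp (- x\<^sup>2 / 2)) * (1 + x\<^sup>2) \<le> exp ((r + 2)\<^sup>2 / 2)" by (simp add: mult_ac)
  moreover have "1 + x\<^sup>2 > 0" by (simp add: add_pos_nonneg)
  ultimately show ?thesis by (simp add: field_simps)
qed

lemma integrable_inverse_one_plus_square:
  "integrable lborel (\<lambda>x::real. inverse (1 + x\<^sup>2))"
  using integrable_inverse_1_plus_square by (simp add: set_integrable_def)

lemma integrable_powr_times_gaussian:
  fixes r :: real
  assumes "0 \<le> r"
  shows "integrable lborel (\<lambda>x. indicator {0<..} x * (x powr r * exp (- x\<^sup>2 / 2)))"
proof (rule Bochner_Integration.integrable_bound)
  show "integrable lborel (\<lambda>x::real. exp ((r + 2)\<^sup>2 / 2) * inverse (1 + x\<^sup>2))"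
    by (intro integrable_mult_right integrable_inverse_one_plus_square)
  show "AE x in lborel. norm (indicator {0<..} x * (x powr r * exp (- x\<^sup>2 / 2)))
      \<le> norm (exp ((r + 2)\<^sup>2 / 2) * inverse (1 + x\<^sup>2))"
  proof (rule AE_I2)
    fix x :: real
    have "1 + x\<^sup>2 > 0" by (simp add: add_pos_nonneg)
    then show "norm (indicator {0<..} x * (x powr r * exp (- x\<^sup>2 / 2)))
      \<le> norm (exp ((r + 2)\<^sup>2 / 2) * inverse (1 + x\<^sup>2))"
      using powr_times_gaussian_le[of x r] assms by (cases "x > 0") auto
  qed
qed measurable

text \<open>Integration by parts: the two integrands differ by the derivative of
  \<open>- (x powr p * exp (- x\<^sup>2 / 2))\<close>, which vanishes at both ends.\<close>

lemma rayleigh_moment_eq: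
  assumes p: "1 \<le> p"
  shows "rayleigh_moment p = (\<integral>x. indicator {0<..} x * (p * x powr (p - 1) * exp (- x\<^sup>2 / 2)) \<partial>lborel)"
proof -
  let ?e = "\<lambda>x::real. exp (- x\<^sup>2 / 2)"
  let ?f = "\<lambda>x. indicator {0<..} x * (x powr (p + 1) * ?e x)"
  let ?g = "\<lambda>x. indicator {0<..} x * (x powr (p - 1) * ?e x)"
  have int: "integrable lborel ?f" "integrable lborel ?g"
    by (rule integrable_powr_times_gaussian, use p in simp)+
  have ein: "einterval 0 \<infinity> = {0<..}"
    by (auto simp: einterval_def zero_ereal_def)
  have dif: "(\<lambda>x. ?f x - p * ?g x) = (\<lambda>x. indicator {0<..} x * (x powr (p + 1) * ?e x - p * (x powr (p - 1) * ?e x)))"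
    by (auto simp: algebra_simps)
  have "(LBINT x=0..\<infinity>. x powr (p + 1) * ?e x - p * (x powr (p - 1) * ?e x)) = 0 - 0"
  proof (rule interval_integral_FTC_integrable[where F = "\<lambda>x. - (x powr p * ?e x)"])
    show "((\<lambda>x. - (x powr p * ?e x)) has_vector_derivative
      (x powr (p + 1) * ?e x - p * (x powr (p - 1) * ?e x))) (at x)" if "0 < ereal x" for x
    proof -
      have "x > 0" using that by (simp add: zero_ereal_def)
      then show ?thesis
        unfolding has_real_derivative_iff_has_vector_derivative[symmetric]
        by (auto intro!: derivative_eq_intros simp: powr_add algebra_simps)
    qed
    show "isCont (\<lambda>x. x powr (p + 1) * ?e x - p * (x powr (p - 1) * ?e x)) x" if "0 < ereal x" for x
      using that by (auto intro!: continuous_intros simp: zero_ereal_def)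
    show "set_integrable lborel (einterval 0 \<infinity>) (\<lambda>x. x powr (p + 1) * ?e x - p * (x powr (p - 1) * ?e x))"
      unfolding ein set_integrable_def real_scaleR_def dif[symmetric]
      using int by auto
    have "((\<lambda>x. - (x powr p * ?e x)) \<longlongrightarrow> 0) (at_right 0)" using p by real_asymp
    then show "(((\<lambda>x. - (x powr p * ?e x)) \<circ> real_of_ereal) \<longlongrightarrow> 0) (at_right 0)"
      by (simp add: zero_ereal_def ereal_tendsto_simps1)
    have "((\<lambda>x. - (x powr p * ?e x)) \<longlongrightarrow> 0) at_top" using p by real_asymp
    then show "(((\<lambda>x. - (x powr p * ?e x)) \<circ> real_of_ereal) \<longlongrightarrow> 0) (at_left \<infinity>)"
      by (simp add: ereal_tendsto_simps1)
  qed simp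
  then have "(\<integral>x. ?f x - p * ?g x \<partial>lborel) = 0"
    unfolding dif by (simp add: interval_lebesgue_integral_def ein set_lebesgue_integral_def)
  then have "integral\<^sup>L lborel ?f = p * integral\<^sup>L lborel ?g"
    using int by simp
  moreover have "rayleigh_moment p = integral\<^sup>L lborel ?f"
    unfolding rayleigh_moment_def set_lebesgue_integral_def
    by (rule Bochner_Integration.integral_cong) (auto simp: powr_add mult_ac split: split_indicator)
  moreover have "(\<integral>x. indicator {0<..} x * (p * x powr (p - 1) * ?e x) \<partial>lborel) = p * integral\<^sup>L lborel ?g"
    unfolding integral_mult_right_zero[symmetric] by (rule Bochner_Integration.integral_cong) auto
  ultimately show ?thesis by simp
qed

text \<open>After integration by parts this is half a Gaussian integral, rescaled by
  \<open>1 / sqrt 2\<close>.\<close>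

lemma rayleigh_moment_1: "rayleigh_moment 1 = sqrt (pi / 2)"
proof -
  have "has_bochner_integral lborel (\<lambda>x. indicator {0..} (0 + (1 / sqrt 2) * x) *\<^sub>R exp (- (0 + (1 / sqrt 2) * x)\<^sup>2))
      ((sqrt pi / 2) /\<^sub>R \<bar>1 / sqrt 2\<bar>)"
    using gaussian_moment_0
    by (subst lborel_has_bochner_integral_real_affine_iff[where c = "1 / sqrt 2" and t = 0, symmetric]) auto
  from has_bochner_integral_integral_eq[OF this]
  have "(\<integral>x. indicator {0..} (0 + (1 / sqrt 2) * x) *\<^sub>R exp (- (0 + (1 / sqrt 2) * x)\<^sup>2) \<partial>lborel)
      = sqrt pi / 2 * sqrt 2" by simp
  also have "sqrt pi / 2 * sqrt 2 = sqrt (pi / 2)"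
    by (simp add: real_sqrt_divide field_simps)
  also have "(\<integral>x. indicator {0..} (0 + (1 / sqrt 2) * x) *\<^sub>R exp (- (0 + (1 / sqrt 2) * x)\<^sup>2) \<partial>lborel)
     = (\<integral>x. indicator {0<..} x * (1 * x powr (1 - 1) * exp (- x\<^sup>2 / 2)) \<partial>lborel)"
  proof (rule integral_cong_AE)
    \<comment> \<open>The indicators of \<open>{0..}\<close> and \<open>{0<..}\<close> differ only
      at \<open>0\<close>.\<close>
    have "AE x in lborel. x \<noteq> (0::real)" by (rule AE_lborel_singleton)
    then show "AE x in lborel. indicator {0..} (0 + (1 / sqrt 2) * x) *\<^sub>R exp (- (0 + (1 / sqrt 2) * x)\<^sup>2)
      = (indicator {0<..} x * (1 * x powr (1 - 1) * exp (- x\<^sup>2 / 2)) :: real)"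
    proof eventually_elim
      case (elim x)
      then show ?case
        by (auto simp: power_divide zero_le_divide_iff split: split_indicator)
    qed
  qed measurable
  finally show ?thesis by (simp only: rayleigh_moment_eq order_refl)
qed

lemma rayleigh_moment_2: "rayleigh_moment 2 = 2"
proof -
  have "has_bochner_integral lborel (\<lambda>x. indicator {0..} x *\<^sub>R (exp (- x\<^sup>2) * x ^ (2 * 0 + 1))) (fact 0 / 2 :: real)"
    by (rule gaussian_moment_odd_pos)
  then have *: "has_bochner_integral lborel (\<lambda>x::real. indicator {0..} x *\<^sub>R (exp (- x\<^sup>2) * x)) (1 / 2)"
    by simp
  have "has_bochner_integral lborel (\<lambda>x. indicator {0..} (0 + (1 / sqrt 2) * x) *\<^sub>R
      (exp (- (0 + (1 / sqrt 2) * x)\<^sup>2) * (0 + (1 / sqrt 2) * x))) ((1 / 2) /\<^sub>R \<bar>1 / sqrt 2\<bar>)"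
    using *
    by (subst lborel_has_bochner_integral_real_affine_iff[where c = "1 / sqrt 2" and t = 0, symmetric]) auto
  from has_bochner_integral_integral_eq[OF this]
  have I: "(\<integral>x. indicator {0..} (0 + (1 / sqrt 2) * x) *\<^sub>R
      (exp (- (0 + (1 / sqrt 2) * x)\<^sup>2) * (0 + (1 / sqrt 2) * x)) \<partial>lborel) = sqrt 2 / 2" by simp
  \<comment> \<open>The factor turns \<open>x / sqrt 2\<close> into the \<open>2 * x\<close> of the
    integrated-by-parts form.\<close>
  have "(2 * sqrt 2) * (\<integral>x. indicator {0..} (0 + (1 / sqrt 2) * x) *\<^sub>R
      (exp (- (0 + (1 / sqrt 2) * x)\<^sup>2) * (0 + (1 / sqrt 2) * x)) \<partial>lborel) = 2" unfolding I by simp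
  also have "(2 * sqrt 2) * (\<integral>x. indicator {0..} (0 + (1 / sqrt 2) * x) *\<^sub>R
      (exp (- (0 + (1 / sqrt 2) * x)\<^sup>2) * (0 + (1 / sqrt 2) * x)) \<partial>lborel)
      = (\<integral>x. indicator {0<..} x * (2 * x powr (2 - 1) * exp (- x\<^sup>2 / 2)) \<partial>lborel)"
    unfolding integral_mult_right_zero[symmetric]
    by (rule Bochner_Integration.integral_cong)
       (auto simp: power_divide zero_le_divide_iff split: split_indicator)
  finally show ?thesis using rayleigh_moment_eq[of 2] by simp
qed

text \<open>The layer-cake formula: write each power as the integral of its derivative from
  \<open>0\<close>, then average over the finitely many maps.\<close>

lemma has_bochner_integral_exp_six_powr:
  assumes K: "K > 0" and p: "1 \<le> p"
  shows "has_bochner_integral lborel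
    (\<lambda>x. indicator {0<..} x * (p * x powr (p - 1) * survival n d v (x * K)))
    (exp_six n d v (\<lambda>s. (real s / K) powr p))"
proof -
  let ?F = "funs_deg n d"
  have "has_bochner_integral lborel
      (\<lambda>x. (\<Sum>f\<in>?F. indicator {0<..<real (six_length f v) / K} x * (p * x powr (p - 1))) / card ?F)
      ((\<Sum>f\<in>?F. (real (six_length f v) / K) powr p) / card ?F)"
    by (intro has_bochner_integral_divide_zero has_bochner_integral_sum has_bochner_integral_powr_deriv)
       (use K p in auto)
  moreover have "(\<Sum>f\<in>?F. indicator {0<..<real (six_length f v) / K} x * (p * x powr (p - 1))) / card ?F
      = indicator {0<..} x * (p * x powr (p - 1) * survival n d v (x * K))" for x
  proof -
    have "indicator {0<..<real (six_length f v) / K} x * (p * x powr (p - 1))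
      = (indicator {0<..} x * (p * x powr (p - 1))) * (if x * K < real (six_length f v) then 1 else 0)" for f
      using K by (auto simp: pos_less_divide_eq split: split_indicator)
    then show ?thesis
      unfolding survival_def exp_six_def by (simp only: sum_distrib_left mult.assoc times_divide_eq_right)
  qed
  ultimately show ?thesis by (simp add: exp_six_def)
qed

subsection \<open>Asymptotics\<close>

locale degree_family =
  fixes d :: "nat \<Rightarrow> nat \<Rightarrow> nat" and v :: "nat \<Rightarrow> nat"
  assumes deg: "\<And>n. n \<ge> 1 \<Longrightarrow> is_degree_seq n (d n)"
    and vert: "\<And>n. n \<ge> 1 \<Longrightarrow> v n \<in> {1..n}"
    and h1: "(\<lambda>n. sigma2 n (d n)) \<in> o(\<lambda>n. real n / (ln (real n)) ^ 3)"
    and h2: "(\<lambda>n. 1 / real n) \<in> o(\<lambda>n. sigma2 n (d n))"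
    and h3: "(\<lambda>n. real (max_deg n (d n)))
               \<in> o(\<lambda>n. sqrt (real n * sigma2 n (d n) / (ln (real n)) ^ 3))"
begin

abbreviation \<sigma> :: "nat \<Rightarrow> real" where "\<sigma> n \<equiv> sigma2 n (d n)"
abbreviation \<Delta> :: "nat \<Rightarrow> real" where "\<Delta> n \<equiv> real (max_deg n (d n))"
text \<open>\<open>K n\<close> is the scale of the six-length and \<open>R n\<close> the Euclidean
  norm of the centred degrees. Eventually \<open>K n * R n = n\<close>, so
  \<open>t = x * K n / n\<close> equals \<open>x / R n\<close>.\<close>

definition K :: "nat \<Rightarrow> real" where "K n = sqrt (real n / \<sigma> n)"
definition R :: "nat \<Rightarrow> real" where "R n = sqrt (real n * \<sigma> n)"

section \<open>Consequences of the growth hypotheses\<close>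

lemma eventually_sigma2_pos: "\<forall>\<^sub>F n in sequentially. \<sigma> n > 0"
proof -
  have "\<forall>\<^sub>F n in sequentially. norm (1 / real n) \<le> 1 * norm (\<sigma> n)"
    by (rule landau_o.smallD[OF h2]) simp
  then show ?thesis using eventually_ge_at_top[of 1]
  proof eventually_elim
    case (elim n)
    have "0 \<le> real n * \<sigma> n"
      unfolding sum_centred_degrees_squared[OF deg[OF elim(2)] elim(2), symmetric] by (rule sum_nonneg) simp
    then have "0 \<le> \<sigma> n" using elim(2) by (simp add: zero_le_mult_iff)
    moreover have "0 < 1 / real n" using elim(2) by simp
    ultimately show ?case using elim(1) unfolding real_norm_def by linarith
  qed
qed

lemma eventually_log_ge_1: "\<forall>\<^sub>F n in sequentially. 1 \<le> ln (real n)"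
  by real_asymp

text \<open>The squared little-o bound on the maximum degree. The power of the logarithm kept here
  later turns a Gaussian bound into a power of \<open>1 / n\<close>.\<close>

lemma eventually_max_deg_le:
  assumes c: "c > 0"
  shows "\<forall>\<^sub>F n in sequentially. c * (\<Delta> n)\<^sup>2 * ln (real n) \<le> real n * \<sigma> n"
proof -
  have "\<forall>\<^sub>F n in sequentially. norm (\<Delta> n) \<le> (1 / sqrt c) * norm (sqrt (real n * \<sigma> n / (ln (real n)) ^ 3))"
    by (rule landau_o.smallD[OF h3]) (use c in simp)
  then show ?thesis using eventually_sigma2_pos eventually_log_ge_1
  proof eventually_elim
    case (elim n)
    have l: "ln (real n) \<le> ln (real n) ^ 3"
      using power_increasing[of 1 3 "ln (real n)"] elim(3) by simp
    have l0: "ln (real n) ^ 3 > 0" using elim(3) by simp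
    have "(\<Delta> n)\<^sup>2 \<le> ((1 / sqrt c) * norm (sqrt (real n * \<sigma> n / (ln (real n)) ^ 3)))\<^sup>2"
      by (rule power_mono) (use elim(1) in auto)
    also have "\<dots> = real n * \<sigma> n / (ln (real n)) ^ 3 / c"
      using c elim l0 by (simp add: power_mult_distrib power_divide)
    finally have "c * (\<Delta> n)\<^sup>2 * ln (real n) ^ 3 \<le> real n * \<sigma> n"
      using c l0 by (simp add: field_simps)
    moreover have "c * (\<Delta> n)\<^sup>2 * ln (real n) \<le> c * (\<Delta> n)\<^sup>2 * ln (real n) ^ 3"
      using l c by (intro mult_left_mono) auto
    ultimately show ?case by linarith
  qed
qed

lemma eventually_basic:
  "\<forall>\<^sub>F n in sequentially. n \<ge> 1 \<and> \<sigma> n > 0 \<and> R n > 0 \<and> K n > 0 \<and> K n * R n = real n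
     \<and> (R n)\<^sup>2 = real n * \<sigma> n \<and> 1 \<le> \<Delta> n"
  using eventually_sigma2_pos eventually_ge_at_top[of 1]
proof eventually_elim
  case (elim n)
  have n: "real n > 0" using elim(2) by simp
  have R: "R n > 0" and K: "K n > 0" unfolding R_def K_def using n elim(1) by auto
  have R2: "(R n)\<^sup>2 = real n * \<sigma> n" unfolding R_def using n elim(1) by simp
  have KR: "K n * R n = real n"
    unfolding K_def R_def real_sqrt_mult[symmetric] using elim(1) by simp
  have D: "1 \<le> \<Delta> n" using max_deg_ge_1[OF deg[OF elim(2)] elim(2)] by simp
  show ?case using KR R K R2 D elim by simp
qed

lemma max_deg_over_R: "(\<lambda>n. \<Delta> n / R n) \<longlonglongrightarrow> 0"
proof (rule tendstoI)
  fix e :: real assume e: "e > 0"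
  \<comment> \<open>Once the logarithm is bounded below by \<open>1\<close>, this constant gives
    \<open>\<Delta> n / R n \<le> e / 2\<close>, strictly below \<open>e\<close>.\<close>
  have "\<forall>\<^sub>F n in sequentially. (4 / e\<^sup>2) * (\<Delta> n)\<^sup>2 * ln (real n) \<le> real n * \<sigma> n"
    by (rule eventually_max_deg_le) (use e in simp)
  then show "\<forall>\<^sub>F n in sequentially. dist (\<Delta> n / R n) 0 < e"
    using eventually_basic eventually_log_ge_1
  proof eventually_elim
    case (elim n)
    have "(4 / e\<^sup>2) * (\<Delta> n)\<^sup>2 * 1 \<le> (4 / e\<^sup>2) * (\<Delta> n)\<^sup>2 * ln (real n)"
      using elim(3) by (intro mult_left_mono) auto
    then have "(2 / e * \<Delta> n)\<^sup>2 \<le> (R n)\<^sup>2"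
      using elim by (simp add: power_mult_distrib power_divide)
    then have "2 / e * \<Delta> n \<le> R n" by (rule power2_le_imp_le) (use elim in simp)
    then have "\<Delta> n / R n \<le> e / 2" using elim e by (simp add: field_simps)
    moreover have "0 \<le> \<Delta> n / R n" using elim(2) by simp
    ultimately show ?case using e unfolding dist_real_def by linarith
  qed
qed

lemma K_at_top: "filterlim K at_top sequentially"
proof (rule filterlim_at_top_dense[THEN iffD2], rule allI)
  fix Z :: real
  have "\<forall>\<^sub>F n in sequentially. norm (\<sigma> n) \<le> (1 / (\<bar>Z\<bar> + 1)\<^sup>2) * norm (real n / (ln (real n)) ^ 3)"
    by (rule landau_o.smallD[OF h1]) (simp add: add_nonneg_pos)
  then show "\<forall>\<^sub>F n in sequentially. Z < K n"
    using eventually_basic eventually_log_ge_1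
  proof eventually_elim
    case (elim n)
    have l: "1 \<le> ln (real n) ^ 3" using elim(3) by simp
    have l0: "0 < ln (real n)" using elim(3) by linarith
    have Z: "(\<bar>Z\<bar> + 1)\<^sup>2 > 0" by (simp add: add_nonneg_pos)
    have "real n / (ln (real n)) ^ 3 \<le> real n / 1" using l l0 by (intro divide_left_mono) auto
    then have "norm (real n / (ln (real n)) ^ 3) \<le> real n" using l0 by simp
    then have "(1 / (\<bar>Z\<bar> + 1)\<^sup>2) * norm (real n / (ln (real n)) ^ 3) \<le> (1 / (\<bar>Z\<bar> + 1)\<^sup>2) * real n"
      by (intro mult_left_mono) auto
    then have "\<sigma> n \<le> real n / (\<bar>Z\<bar> + 1)\<^sup>2" using elim by simp
    then have "(\<bar>Z\<bar> + 1)\<^sup>2 \<le> real n / \<sigma> n" using elim(2) Z by (simp add: field_simps)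
    then have "\<bar>Z\<bar> + 1 \<le> K n" unfolding K_def by (simp add: real_le_rsqrt)
    then show ?case by linarith
  qed
qed

section \<open>Convergence of the survival function\<close>

text \<open>With \<open>t = x / R n\<close> the terms \<open>c j * t\<close> are uniformly at most
  \<open>x * \<Delta> n / R n\<close>, which tends to \<open>0\<close>, while their squares sum to
  exactly \<open>x^2\<close>. The second-order bounds therefore squeeze the product.\<close>

lemma walk_gf_tendsto:
  assumes x: "x > 0"
  shows "(\<lambda>n. walk_gf n (d n) (v n) (x * K n / real n)) \<longlonglongrightarrow> exp (- x\<^sup>2 / 2)"
proof -
  define t where "t n = x * K n / real n" for n
  let ?c = "\<lambda>n j. real (d n j) - 1"
  let ?u = "\<lambda>n. ?c n (v n) * t n"
  let ?P = "\<lambda>n. \<Prod>j\<in>{1..n}. 1 + ?c n j * t n"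
  have t_eq: "\<forall>\<^sub>F n in sequentially. n \<ge> 1 \<and> 0 \<le> t n \<and> \<Delta> n * t n = x * (\<Delta> n / R n) \<and>
      (t n)\<^sup>2 * (\<Sum>j\<in>{1..n}. (?c n j)\<^sup>2) = x\<^sup>2"
    using eventually_basic
  proof eventually_elim
    case (elim n)
    then have n: "real n = K n * R n" "K n \<noteq> 0" "R n \<noteq> 0" "n \<ge> 1" "0 < x" "0 < K n" "0 < R n" using x by auto
    have t: "t n = x / R n" unfolding t_def n(1) using n by simp
    have "(\<Sum>j\<in>{1..n}. (?c n j)\<^sup>2) = (R n)\<^sup>2"
      using sum_centred_degrees_squared[OF deg n(4)] n(4) elim by simp
    then have "(t n)\<^sup>2 * (\<Sum>j\<in>{1..n}. (?c n j)\<^sup>2) = x\<^sup>2"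
      unfolding t using n(3) by (simp add: power_divide)
    then show ?case using t n by simp
  qed
  have Dt: "(\<lambda>n. \<Delta> n * t n) \<longlonglongrightarrow> 0"
  proof -
    have "(\<lambda>n. x * (\<Delta> n / R n)) \<longlonglongrightarrow> x * 0" by (intro tendsto_intros max_deg_over_R)
    moreover have "\<forall>\<^sub>F n in sequentially. x * (\<Delta> n / R n) = \<Delta> n * t n"
      using t_eq by eventually_elim simp
    ultimately show ?thesis using tendsto_cong by force
  qed
  have small: "\<bar>?c n j * t n\<bar> \<le> \<Delta> n * t n" if "n \<ge> 1" "0 \<le> t n" "j \<in> {1..n}" for n j
    using mult_right_mono[OF centred_degree_bound[OF deg[OF that(1)] that(3)] that(2)]
    by (simp only: abs_mult abs_of_nonneg[OF that(2)])
  have u0: "?u \<longlonglongrightarrow> 0"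
  proof (rule Lim_null_comparison[OF _ Dt])
    show "\<forall>\<^sub>F n in sequentially. norm (?u n) \<le> \<Delta> n * t n"
      using t_eq by eventually_elim (unfold real_norm_def, use small vert in blast)
  qed
  have t0: "t \<longlonglongrightarrow> 0"
  proof (rule Lim_null_comparison[OF _ Dt])
    show "\<forall>\<^sub>F n in sequentially. norm (t n) \<le> \<Delta> n * t n"
      using t_eq eventually_basic
    proof eventually_elim
      case (elim n)
      then have "1 * t n \<le> \<Delta> n * t n" by (intro mult_right_mono) auto
      then show ?case using elim by simp
    qed
  qed
  have P: "?P \<longlonglongrightarrow> exp (- x\<^sup>2 / 2)"
  proof (rule tendstoI)
    fix r :: real assume r: "r > 0"
    \<comment> \<open>First fix \<open>e\<close> so that both bounding exponentials lie within
      \<open>r\<close> of the limit; only then choose \<open>\<delta>\<close> for this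
      \<open>e\<close>.\<close>
    have "((\<lambda>e. exp (- (1/2 + e) * x\<^sup>2)) \<longlongrightarrow> exp (- (1/2 + 0) * x\<^sup>2)) (at_right 0)"
      "((\<lambda>e. exp (- (1/2 - e) * x\<^sup>2)) \<longlongrightarrow> exp (- (1/2 - 0) * x\<^sup>2)) (at_right 0)"
      by (intro tendsto_intros)+
    from tendstoD[OF this(1) r] tendstoD[OF this(2) r] eventually_at_right_less[of "0::real"]
    have "\<forall>\<^sub>F e in at_right 0. 0 < e \<and> dist (exp (- (1/2 + e) * x\<^sup>2)) (exp (- x\<^sup>2 / 2)) < r
      \<and> dist (exp (- (1/2 - e) * x\<^sup>2)) (exp (- x\<^sup>2 / 2)) < r"
      by eventually_elim simp
    then obtain e where e: "0 < e" "dist (exp (- (1/2 + e) * x\<^sup>2)) (exp (- x\<^sup>2 / 2)) < r"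
      "dist (exp (- (1/2 - e) * x\<^sup>2)) (exp (- x\<^sup>2 / 2)) < r"
      using eventually_happens'[OF trivial_limit_at_right_real] by blast
    obtain \<delta> :: real where \<delta>: "0 < \<delta>" "\<delta> < 1"
      "\<And>u. \<bar>u\<bar> \<le> \<delta> \<Longrightarrow> \<bar>ln (1 + u) - u + u\<^sup>2 / 2\<bar> \<le> e * u\<^sup>2"
      using ln_one_plus_quadratic[OF e(1)] by blast
    from t_eq tendstoD[OF Dt \<delta>(1)]
    show "\<forall>\<^sub>F n in sequentially. dist (?P n) (exp (- x\<^sup>2 / 2)) < r"
    proof eventually_elim
      case (elim n)
      have le: "\<bar>?c n j * t n\<bar> \<le> \<delta>" if "j \<in> {1..n}" for j
      proof -
        have "1 \<le> n" "0 \<le> t n" using elim(1) by auto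
        from small[OF this that] show ?thesis using elim(2) unfolding dist_real_def by linarith
      qed
      have "(\<Sum>j\<in>{1..n}. ?c n j) = 0" using sum_centred_degrees[OF deg] elim by blast
      from prod_one_plus_bounds[OF \<delta>(3,2) finite_atLeastAtMost this le]
      have "exp (- (1/2 + e) * x\<^sup>2) \<le> ?P n" "?P n \<le> exp (- (1/2 - e) * x\<^sup>2)"
        using elim by simp_all
      then show ?case using e by (simp add: dist_real_def abs_less_iff)
    qed
  qed
  \<comment> \<open>Exchanging the factor of \<open>v n\<close> for \<open>1 - t n\<close> costs a
    ratio tending to \<open>1\<close>, even if the degree of \<open>v n\<close> grows with
    \<open>n\<close>.\<close>
  have "(\<lambda>n. (1 - t n) / (1 + ?u n) * ?P n) \<longlonglongrightarrow> (1 - 0) / (1 + 0) * exp (- x\<^sup>2 / 2)"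
    by (intro tendsto_intros t0 u0 P) simp
  moreover have "\<forall>\<^sub>F n in sequentially. (1 - t n) / (1 + ?u n) * ?P n = walk_gf n (d n) (v n) (t n)"
    using t_eq tendstoD[OF u0, of 1, simplified]
  proof eventually_elim
    case (elim n)
    show ?case
      by (rule walk_gf_eq_prod[symmetric]) (use vert elim in \<open>auto simp: dist_real_def\<close>)
  qed
  ultimately show ?thesis unfolding t_def by (simp add: tendsto_cong)
qed

text \<open>Since \<open>\<Delta> n \<ge> 1\<close> and \<open>\<Delta> n / R n\<close> tends to
  \<open>0\<close>, \<open>R n\<close> is unbounded. For fixed \<open>x\<close> this makes
  \<open>x * K n \<le> n\<close> eventually.\<close>

lemma eventually_le_R: "\<forall>\<^sub>F n in sequentially. c \<le> R n"
proof -
  have "0 < 1 / (\<bar>c\<bar> + 1)" by simp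
  from tendstoD[OF max_deg_over_R this] eventually_basic show ?thesis
  proof eventually_elim
    case (elim n)
    then have R: "R n > 0" and D: "1 \<le> \<Delta> n" by auto
    have "1 / R n \<le> \<Delta> n / R n" using R D by (intro divide_right_mono) auto
    also have "\<dots> < 1 / (\<bar>c\<bar> + 1)" using elim(1) unfolding dist_real_def by linarith
    finally show ?case using R by (simp add: field_simps)
  qed
qed

text \<open>Compare with the generating function at \<open>(x - e) * K n\<close> from above and at
  \<open>(x + e) * K n\<close> from below. The Chebyshev error for a window of width
  \<open>e * K n\<close> is of order \<open>1 / K n\<close>, and continuity of the Gaussian removes
  the shift \<open>e\<close>.\<close>

lemma survival_tendsto:
  assumes x: "x > 0"
  shows "(\<lambda>n. survival n (d n) (v n) (x * K n)) \<longlonglongrightarrow> exp (- x\<^sup>2 / 2)"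
proof (rule tendstoI)
  fix r :: real assume "r > 0"
  then have r: "r / 2 > 0" by simp
  have "((\<lambda>e. exp (- (x - e)\<^sup>2 / 2)) \<longlongrightarrow> exp (- (x - 0)\<^sup>2 / 2)) (at_right 0)"
    "((\<lambda>e. exp (- (x + e)\<^sup>2 / 2)) \<longlongrightarrow> exp (- (x + 0)\<^sup>2 / 2)) (at_right 0)"
    by (intro tendsto_intros; simp)+
  from tendstoD[OF this(1) r] tendstoD[OF this(2) r] eventually_at_right_real[OF x]
  have "\<forall>\<^sub>F e in at_right 0. e \<in> {0<..<x} \<and> dist (exp (- (x - e)\<^sup>2 / 2)) (exp (- x\<^sup>2 / 2)) < r / 2
      \<and> dist (exp (- (x + e)\<^sup>2 / 2)) (exp (- x\<^sup>2 / 2)) < r / 2"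
    by eventually_elim simp
  then obtain e where "e \<in> {0<..<x}" and e':
      "dist (exp (- (x - e)\<^sup>2 / 2)) (exp (- x\<^sup>2 / 2)) < r / 2"
      "dist (exp (- (x + e)\<^sup>2 / 2)) (exp (- x\<^sup>2 / 2)) < r / 2"
    using eventually_happens'[OF trivial_limit_at_right_real] by blast
  then have e: "0 < e" "e < x" by auto
  have err: "(\<lambda>n. c / K n) \<longlonglongrightarrow> 0" for c
    by (rule real_tendsto_divide_at_top[OF tendsto_const K_at_top])
  have upper: "(\<lambda>n. walk_gf n (d n) (v n) ((x - e) * K n / real n) + ((x - e) / e\<^sup>2) / K n)
      \<longlonglongrightarrow> exp (- (x - e)\<^sup>2 / 2) + 0"
    by (intro tendsto_add walk_gf_tendsto err) (use e in simp)
  have lower: "(\<lambda>n. walk_gf n (d n) (v n) ((x + e) * K n / real n) - ((x + e) / e\<^sup>2) / K n)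
      \<longlonglongrightarrow> exp (- (x + e)\<^sup>2 / 2) - 0"
    by (intro tendsto_diff walk_gf_tendsto err) (use e x in simp)
  from tendstoD[OF upper r] tendstoD[OF lower r] eventually_basic eventually_le_R[of "x + e"]
  show "\<forall>\<^sub>F n in sequentially. dist (survival n (d n) (v n) (x * K n)) (exp (- x\<^sup>2 / 2)) < r"
  proof eventually_elim
    case (elim n)
    then have n: "n \<ge> 1" and K: "K n > 0" and KR: "K n * R n = real n" by auto
    have "(x + e) * K n \<le> R n * K n" using elim(4) K by (intro mult_right_mono) auto
    then have le: "(x + e) * K n \<le> real n" using KR by (simp add: mult.commute)
    have "(x - e) * K n \<le> (x + e) * K n" using K e by (intro mult_right_mono) auto
    then have le': "(x - e) * K n \<le> real n" using le by simp
    have eq: "a * K n / (e * K n)\<^sup>2 = (a / e\<^sup>2) / K n" for a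
      using K e by (simp add: power2_eq_square)
    have "survival n (d n) (v n) ((x - e) * K n + e * K n)
        \<le> walk_gf n (d n) (v n) ((x - e) * K n / real n) + (x - e) * K n / (e * K n)\<^sup>2"
      by (rule survival_le_walk_gf_shift) (use n deg vert le' K e in auto)
    then have up: "survival n (d n) (v n) (x * K n)
        \<le> walk_gf n (d n) (v n) ((x - e) * K n / real n) + ((x - e) / e\<^sup>2) / K n"
      unfolding eq by (simp add: algebra_simps)
    have "walk_gf n (d n) (v n) ((x + e) * K n / real n)
        \<le> survival n (d n) (v n) ((x + e) * K n - e * K n) + (x + e) * K n / (e * K n)\<^sup>2"
      by (rule walk_gf_le_survival_shift) (use n deg vert le K e x in auto)
    then have lo: "walk_gf n (d n) (v n) ((x + e) * K n / real n) - ((x + e) / e\<^sup>2) / K n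
        \<le> survival n (d n) (v n) (x * K n)"
      unfolding eq by (simp add: algebra_simps)
    show ?case using up lo elim(1,2) e' unfolding dist_real_def by linarith
  qed
qed

section \<open>Uniform tail bounds\<close>

text \<open>Up to \<open>x = 2 * \<delta> * R n / \<Delta> n\<close> the generating function gives a Gaussian bound; there the
  logarithmic gap in the hypothesis on the maximum degree has already pushed it below any power of
  \<open>1 / n\<close>, and \<open>x * K n\<close> never exceeds \<open>n\<close>.\<close>

lemma eventually_survival_le_powr:
  fixes q :: real
  assumes q: "q > 0"
  shows "\<forall>\<^sub>F n in sequentially. \<forall>x\<ge>1. survival n (d n) (v n) (x * K n) \<le> 2 * exp (4 * q\<^sup>2) * x powr (- q)"
proof -
  have e: "(1/4::real) > 0" by simp
  obtain \<delta> :: real where \<delta>: "0 < \<delta>" "\<delta> < 1"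
    "\<And>u. \<bar>u\<bar> \<le> \<delta> \<Longrightarrow> \<bar>ln (1 + u) - u + u\<^sup>2 / 2\<bar> \<le> (1/4) * u\<^sup>2"
    using ln_one_plus_quadratic[OF e] by blast
  \<comment> \<open>Chosen so that the Gaussian exponent \<open>X^2 / 16\<close> at
    \<open>X = 2 * \<delta> * R n / \<Delta> n\<close> is at least \<open>q * ln n\<close>.\<close>
  have c: "4 * q / \<delta>\<^sup>2 > 0" using q \<delta> by simp
  from eventually_max_deg_le[OF c] eventually_basic filterlim_at_top[THEN iffD1, rule_format, OF K_at_top, of 1]
  show ?thesis
  proof eventually_elim
    case (elim n)
    then have n: "n \<ge> 1" "real n > 0" and K: "K n > 0" and R: "R n > 0" and KR: "K n * R n = real n"
      and R2: "(R n)\<^sup>2 = real n * \<sigma> n" and D: "1 \<le> \<Delta> n" and K1: "1 \<le> K n" by auto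
    let ?Q = "\<lambda>x. survival n (d n) (v n) (x * K n)"
    \<comment> \<open>Here \<open>t = y / (2 * R n)\<close>, so the last condition on
      \<open>y\<close> says \<open>\<Delta> n * t \<le> \<delta>\<close>. The exponent
      \<open>16\<close> combines \<open>1/2 - 1/4\<close> with the halved \<open>t\<close>.\<close>
    have gauss: "?Q y \<le> 2 * exp (- y\<^sup>2 / 16)" if y: "0 < y" "y * K n \<le> real n" "y * \<Delta> n \<le> 2 * \<delta> * R n" for y
    proof -
      define t where "t = y * K n / (2 * real n)"
      have t_eq: "t = y / (2 * R n)" unfolding t_def KR[symmetric] using K by simp
      have t: "0 \<le> t" "t \<le> 1" using y K n unfolding t_def by (auto simp: field_simps)
      have Dt: "\<Delta> n * t \<le> \<delta>" using y(3) R unfolding t_eq by (simp add: field_simps)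
      have le: "\<bar>(real (d n j) - 1) * t\<bar> \<le> \<delta>" if "j \<in> {1..n}" for j
        using mult_right_mono[OF centred_degree_bound[OF deg[OF n(1)] that] t(1)] Dt
        by (simp only: abs_mult abs_of_nonneg[OF t(1)])
      have "?Q y \<le> 2 * walk_gf n (d n) (v n) t"
        unfolding t_def by (rule survival_le_walk_gf) (use deg vert n y K in auto)
      also have "\<dots> \<le> 2 * (\<Prod>j\<in>{1..n}. 1 + (real (d n j) - 1) * t)"
        using walk_gf_le_prod[OF vert[OF n(1)] t, of "d n"] by simp
      also have "\<dots> \<le> 2 * exp (- (1/2 - 1/4) * (t\<^sup>2 * (\<Sum>j\<in>{1..n}. (real (d n j) - 1)\<^sup>2)))"
        using prod_one_plus_bounds(2)[OF \<delta>(3,2) finite_atLeastAtMost sum_centred_degrees[OF deg[OF n(1)]] le]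
        by simp
      also have "t\<^sup>2 * (\<Sum>j\<in>{1..n}. (real (d n j) - 1)\<^sup>2) = y\<^sup>2 / 4"
        unfolding sum_centred_degrees_squared[OF deg[OF n(1)] n(1)] R2[symmetric] t_eq
        using R by (simp add: power_divide power_mult_distrib)
      finally show ?thesis by simp
    qed
    show ?case
    proof (intro allI impI)
      fix x :: real assume x: "1 \<le> x"
      show "?Q x \<le> 2 * exp (4 * q\<^sup>2) * x powr (- q)"
      proof (cases "real n \<le> x * K n")
        case True
        then have "?Q x = 0" by (intro survival_eq_0 deg vert n)
        then show ?thesis by simp
      next
        case False
        define X where "X = 2 * \<delta> * R n / \<Delta> n"
        show ?thesis
        proof (cases "x \<le> X")
          case True
          then have "?Q x \<le> 2 * exp (- x\<^sup>2 / 16)"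
            using False x D unfolding X_def by (intro gauss) (auto simp: field_simps)
          also have "exp (- x\<^sup>2 / 16) \<le> exp (4 * q\<^sup>2) * exp (- (q * x))"
          proof -
            have "0 \<le> (x / 4 - 2 * q)\<^sup>2" by simp
            then show ?thesis unfolding mult_exp_exp by (simp add: power2_eq_square algebra_simps)
          qed
          also have "exp (- (q * x)) \<le> x powr (- q)"
            using powr_le_exp[of x q] x q by (simp add: powr_minus exp_minus le_imp_inverse_le)
          finally show ?thesis by simp
        next
          case False': False
          have X0: "X > 0" unfolding X_def using \<delta> R D by simp
          have XK: "X * K n \<le> x * K n" using False' K by (intro mult_right_mono) auto
          have "?Q x \<le> ?Q X" using antimonoD[OF antimono_survival XK] .
          also have "\<dots> \<le> 2 * exp (- X\<^sup>2 / 16)"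
            using False XK D X0 by (intro gauss) (auto simp: X_def)
          also have "exp (- X\<^sup>2 / 16) \<le> real n powr (- q)"
          proof -
            have "4 * q / \<delta>\<^sup>2 * (\<Delta> n)\<^sup>2 * ln (real n) \<le> (R n)\<^sup>2" using elim(1) R2 by simp
            moreover have "(R n)\<^sup>2 = X\<^sup>2 * (\<Delta> n)\<^sup>2 / (4 * \<delta>\<^sup>2)"
              unfolding X_def using D \<delta> by (simp add: power_mult_distrib power_divide)
            ultimately have "q * ln (real n) \<le> X\<^sup>2 / 16"
              using D \<delta>(1) by (simp add: field_simps)
            then show ?thesis using n by (simp add: powr_def)
          qed
          \<comment> \<open>The case \<open>x * K n < n\<close> means \<open>x < R n\<close>, and
            \<open>R n \<le> n\<close> because \<open>K n \<ge> 1\<close>.\<close>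
          also have "real n powr (- q) \<le> x powr (- q)"
          proof -
            have "R n * K n = real n" using KR by (simp add: mult.commute)
            then have "x * K n \<le> R n * K n" using False by simp
            then have "x \<le> R n" using K by simp
            also have "\<dots> \<le> real n"
              using mult_right_mono[OF K1, of "R n"] R KR by simp
            finally show ?thesis using x q by (intro powr_mono2') auto
          qed
          also have "2 * x powr (- q) \<le> 2 * exp (4 * q\<^sup>2) * x powr (- q)"
            by (intro mult_right_mono) auto
          finally show ?thesis by simp
        qed
      qed
    qed
  qed
qed

section \<open>Convergence of the moments\<close>

text \<open>Dominated convergence in the layer-cake formula, with the limit identified by
  integration by parts.\<close>

lemma moment_tendsto:
  assumes p: "1 \<le> p"
  shows "(\<lambda>n. exp_six n (d n) (v n) (\<lambda>s. (real s / K n) powr p)) \<longlonglongrightarrow> rayleigh_moment p"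
proof -
  let ?C = "2 * exp (4 * (p + 1)\<^sup>2)"
  let ?g = "\<lambda>n x. indicator {0<..} x * (p * x powr (p - 1) * survival n (d n) (v n) (x * K n))"
  let ?h = "\<lambda>x. indicator {0<..} x * (p * x powr (p - 1) * exp (- x\<^sup>2 / 2))"
  \<comment> \<open>With tail exponent \<open>p + 1\<close>, the integrand beyond \<open>1\<close>
    decays like \<open>x powr (p - 1) * x powr (- (p + 1))\<close>, that is
    \<open>1 / x^2\<close>.\<close>
  have "p + 1 > 0" using p by simp
  from eventually_survival_le_powr[OF this] eventually_basic
  have "\<forall>\<^sub>F n in sequentially. K n > 0 \<and> (\<forall>x\<ge>1. survival n (d n) (v n) (x * K n) \<le> ?C * x powr (- (p + 1)))"
    by eventually_elim simp
  then obtain N where N: "\<And>n. n \<ge> N \<Longrightarrow> K n > 0"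
    "\<And>n x. n \<ge> N \<Longrightarrow> 1 \<le> x \<Longrightarrow> survival n (d n) (v n) (x * K n) \<le> ?C * x powr (- (p + 1))"
    unfolding eventually_sequentially by blast
  have int: "has_bochner_integral lborel (?g n) (exp_six n (d n) (v n) (\<lambda>s. (real s / K n) powr p))"
    if "n \<ge> N" for n by (rule has_bochner_integral_exp_six_powr[OF N(1)[OF that] p])
  \<comment> \<open>The sequence is shifted by \<open>N\<close> so that domination holds for every
    index. The majorant covers both the constant bound \<open>p\<close> on \<open>(0, 1]\<close> and
    the \<open>1 / x^2\<close> decay beyond.\<close>
  have "(\<lambda>n. integral\<^sup>L lborel (?g (n + N))) \<longlonglongrightarrow> integral\<^sup>L lborel ?h"
  proof (rule integral_dominated_convergence[where w = "\<lambda>x. 2 * p * ?C * inverse (1 + x\<^sup>2)"])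
    show "?h \<in> borel_measurable lborel" by measurable
    show "?g (n + N) \<in> borel_measurable lborel" for n
      using int[of "n + N"] by (intro borel_measurable_has_bochner_integral) simp
    show "integrable lborel (\<lambda>x::real. 2 * p * ?C * inverse (1 + x\<^sup>2))"
      by (intro integrable_mult_right integrable_inverse_one_plus_square)
    show "AE x in lborel. (\<lambda>n. ?g (n + N) x) \<longlonglongrightarrow> ?h x"
    proof (rule AE_I2)
      fix x :: real
      show "(\<lambda>n. ?g (n + N) x) \<longlonglongrightarrow> ?h x"
      proof (cases "x > 0")
        case True
        show ?thesis
          by (intro tendsto_intros LIMSEQ_ignore_initial_segment[OF survival_tendsto] True)
      qed simp
    qed
    show "AE x in lborel. norm (?g (n + N) x) \<le> 2 * p * ?C * inverse (1 + x\<^sup>2)" for n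
    proof (rule AE_I2)
      fix x :: real
      let ?s = "survival (n + N) (d (n + N)) (v (n + N)) (x * K (n + N))"
      have pos: "1 + x\<^sup>2 > 0" by (simp add: add_pos_nonneg)
      have "1 \<le> exp (4 * (p + 1)\<^sup>2)" by simp
      then have C: "1 \<le> ?C" by linarith
      consider "x \<le> 0" | "0 < x" "x \<le> 1" | "1 < x" by linarith
      then show "norm (?g (n + N) x) \<le> 2 * p * ?C * inverse (1 + x\<^sup>2)"
      proof cases
        case 1
        then show ?thesis using p pos by simp
      next
        case 2
        have "x powr (p - 1) \<le> 1" using 2 p powr_mono2[of "p - 1" x 1] by simp
        then have "p * x powr (p - 1) * ?s \<le> p * 1 * 1"
          using p survival_le_1 survival_nonneg by (intro mult_mono) auto
        also have "p * 1 * 1 \<le> 2 * p * ?C * inverse (1 + x\<^sup>2)"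
        proof -
          have "x\<^sup>2 \<le> 1" using 2 by (simp add: power_le_one)
          then have "1 \<le> 2 * inverse (1 + x\<^sup>2)" using pos by (simp add: field_simps)
          then have "1 * 1 \<le> ?C * (2 * inverse (1 + x\<^sup>2))" using C by (intro mult_mono) auto
          then have "p * (1 * 1) \<le> p * (?C * (2 * inverse (1 + x\<^sup>2)))" using p by (intro mult_left_mono) auto
          then show ?thesis by (simp add: mult_ac)
        qed
        finally show ?thesis using 2 p survival_nonneg by (simp add: abs_mult)
      next
        case 3
        have "p * x powr (p - 1) * ?s \<le> p * x powr (p - 1) * (?C * x powr (- (p + 1)))"
          using 3 p N(2)[of "n + N" x] by (intro mult_left_mono) auto
        also have "\<dots> = p * ?C * (x powr (p - 1) * x powr (- (p + 1)))" by (simp only: mult_ac)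
        also have "x powr (p - 1) * x powr (- (p + 1)) = inverse (x\<^sup>2)"
        proof -
          have "x powr (p - 1) * x powr (- (p + 1)) = x powr (- 2)"
            unfolding powr_add[symmetric] by simp
          then show ?thesis using 3 by (simp add: powr_minus)
        qed
        also have "p * ?C * inverse (x\<^sup>2) \<le> p * ?C * (2 * inverse (1 + x\<^sup>2))"
        proof -
          have "1 \<le> x\<^sup>2" using 3 by simp
          moreover have "x\<^sup>2 > 0" using 3 by simp
          ultimately have "inverse (x\<^sup>2) \<le> 2 * inverse (1 + x\<^sup>2)" using pos by (simp add: field_simps)
          then show ?thesis using p by (intro mult_left_mono) auto
        qed
        finally have "p * x powr (p - 1) * ?s \<le> 2 * p * ?C * inverse (1 + x\<^sup>2)" by (simp add: mult_ac)
        then show ?thesis using 3 p survival_nonneg by (simp add: abs_mult)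
      qed
    qed
  qed
  moreover have "integral\<^sup>L lborel (?g (n + N))
      = exp_six (n + N) (d (n + N)) (v (n + N)) (\<lambda>s. (real s / K (n + N)) powr p)" for n
    using int[of "n + N"] by (simp add: has_bochner_integral_integral_eq)
  ultimately have "(\<lambda>n. exp_six (n + N) (d (n + N)) (v (n + N)) (\<lambda>s. (real s / K (n + N)) powr p))
      \<longlonglongrightarrow> rayleigh_moment p"
    unfolding rayleigh_moment_eq[OF p] by simp
  then show ?thesis by (rule LIMSEQ_offset)
qed

end

section \<open>Mean and variance\<close>

lemma exp_six_divide: "exp_six n d v (\<lambda>s. g s / c) = exp_six n d v g / c"
  by (simp add: exp_six_def sum_divide_distrib[symmetric])

theorem theorem2p2:
  fixes d :: "nat \<Rightarrow> nat \<Rightarrow> nat" and v :: "nat \<Rightarrow> nat"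
  assumes deg: "\<And>n. n \<ge> 1 \<Longrightarrow> is_degree_seq n (d n)"
    and vert: "\<And>n. n \<ge> 1 \<Longrightarrow> v n \<in> {1..n}"
    and h1: "(\<lambda>n. sigma2 n (d n)) \<in> o(\<lambda>n. real n / (ln (real n)) ^ 3)"
    and h2: "(\<lambda>n. 1 / real n) \<in> o(\<lambda>n. sigma2 n (d n))"
    and h3: "(\<lambda>n. real (max_deg n (d n)))
               \<in> o(\<lambda>n. sqrt (real n * sigma2 n (d n) / (ln (real n)) ^ 3))"
  shows "(\<forall>p::real. p \<ge> 1 \<longrightarrow>
           (\<lambda>n. exp_six n (d n) (v n)
                  (\<lambda>s. (real s / sqrt (real n / sigma2 n (d n))) powr p))
           \<longlonglongrightarrow> rayleigh_moment p)
      \<and> (\<lambda>n. exp_six n (d n) (v n) real)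
           \<sim>[at_top] (\<lambda>n. sqrt (pi * real n / (2 * sigma2 n (d n))))
      \<and> (\<lambda>n. exp_six n (d n) (v n) (\<lambda>s. (real s)\<^sup>2) - (exp_six n (d n) (v n) real)\<^sup>2)
           \<sim>[at_top] (\<lambda>n. (4 - pi) * real n / (2 * sigma2 n (d n)))"
proof -
  interpret degree_family d v
    by unfold_locales (fact deg vert h1 h2 h3)+
  let ?E = "\<lambda>n. exp_six n (d n) (v n)"
  have powr_2: "(real s / c) powr 2 = (real s)\<^sup>2 / c\<^sup>2" if "c > 0" for s and c :: real
    using that by (simp add: power_divide)
  have K2: "\<forall>\<^sub>F n in sequentially. K n > 0 \<and> (K n)\<^sup>2 = real n / \<sigma> n"
    using eventually_basic by eventually_elim (simp add: K_def)
  have mean: "(\<lambda>n. ?E n real / K n) \<longlonglongrightarrow> sqrt (pi / 2)"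
  proof -
    have "\<forall>\<^sub>F n in sequentially. ?E n (\<lambda>s. (real s / K n) powr 1) = ?E n real / K n"
      using K2 by eventually_elim (simp add: exp_six_divide)
    from tendsto_cong[OF this] show ?thesis using moment_tendsto[of 1] by (simp add: rayleigh_moment_1)
  qed
  have second: "(\<lambda>n. ?E n (\<lambda>s. (real s)\<^sup>2) / (K n)\<^sup>2) \<longlonglongrightarrow> 2"
  proof -
    have "\<forall>\<^sub>F n in sequentially. ?E n (\<lambda>s. (real s / K n) powr 2) = ?E n (\<lambda>s. (real s)\<^sup>2) / (K n)\<^sup>2"
      using K2 by eventually_elim (simp only: powr_2 exp_six_divide)
    from tendsto_cong[OF this] show ?thesis using moment_tendsto[of 2] by (simp add: rayleigh_moment_2)
  qed
  have asymp: "f \<sim>[at_top] g"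
    if "(\<lambda>n. f n / h n) \<longlonglongrightarrow> c" "c \<noteq> 0" "\<forall>\<^sub>F n in sequentially. h n \<noteq> 0 \<and> g n = c * h n"
    for f g h :: "nat \<Rightarrow> real" and c
  proof (rule asymp_equivI')
    have "(\<lambda>n. f n / h n / c) \<longlonglongrightarrow> c / c" by (intro tendsto_intros that)
    moreover have "\<forall>\<^sub>F n in sequentially. f n / h n / c = f n / g n"
      using that(3) by eventually_elim (simp add: mult.commute)
    ultimately have "(\<lambda>n. f n / g n) \<longlonglongrightarrow> c / c" by (rule Lim_transform_eventually)
    then show "(\<lambda>n. f n / g n) \<longlonglongrightarrow> 1" using that(2) by simp
  qed
  have "(\<lambda>n. ?E n real) \<sim>[at_top] (\<lambda>n. sqrt (pi * real n / (2 * \<sigma> n)))"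
  proof (rule asymp[OF mean])
    show "\<forall>\<^sub>F n in sequentially. K n \<noteq> 0 \<and> sqrt (pi * real n / (2 * \<sigma> n)) = sqrt (pi / 2) * K n"
      using eventually_basic by eventually_elim (simp add: K_def real_sqrt_mult[symmetric])
  qed simp
  moreover have "(\<lambda>n. ?E n (\<lambda>s. (real s)\<^sup>2) - (?E n real)\<^sup>2) \<sim>[at_top] (\<lambda>n. (4 - pi) * real n / (2 * \<sigma> n))"
  proof (rule asymp)
    \<comment> \<open>The variance divided by \<open>(K n)^2\<close> tends to
      \<open>2 - pi / 2\<close>. This limit is nonzero, which is what upgrades the convergence to
      asymptotic equivalence.\<close>
    have "(\<lambda>n. ?E n (\<lambda>s. (real s)\<^sup>2) / (K n)\<^sup>2 - (?E n real / K n)\<^sup>2) \<longlonglongrightarrow> 2 - (sqrt (pi / 2))\<^sup>2"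
      by (intro tendsto_intros mean second)
    then show "(\<lambda>n. (?E n (\<lambda>s. (real s)\<^sup>2) - (?E n real)\<^sup>2) / (K n)\<^sup>2) \<longlonglongrightarrow> (4 - pi) / 2"
      by (simp add: power_divide diff_divide_distrib)
    show "(4 - pi) / 2 \<noteq> 0" using pi_less_4 by simp
    show "\<forall>\<^sub>F n in sequentially. (K n)\<^sup>2 \<noteq> 0 \<and> (4 - pi) * real n / (2 * \<sigma> n) = (4 - pi) / 2 * (K n)\<^sup>2"
      using eventually_basic K2 by eventually_elim simp
  qed
  ultimately show ?thesis
    using moment_tendsto unfolding K_def by blast
qed

end
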